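(* Let $\mathfrak{h}$ be a finite-dimensional complex vector space with a nondegenerate symmetric bilinear form $\langle\cdot,\cdot\rangle$, and let $\mathrm{O}(\mathfrak{h})=\mathrm{Aut}(\mathfrak{h},\langle\cdot,\cdot\rangle)$ be the group of linear automorphisms of $\mathfrak{h}$ preserving the form. Identify an automorphism of $V_{\widehat{\mathfrak{h}}}(1,0)$ preserving the standard gradation with its restriction to $V_{\widehat{\mathfrak{h}}}(1,0)_1\cong\mathfrak{h}$. Then: 1) The group of automorphisms of the Heisenberg vertex algebra $V_{\widehat{\mathfrak{h}}}(1,0)$ preserving the standard gradation is $$\mathrm{Aut}^{gr}_{VA}(V_{\widehat{\mathfrak{h}}}(1,0))=\mathrm{Aut}(\mathfrak{h},\langle\cdot,\cdot\rangle)\cong \mathrm{O}(\mathfrak{h}).$$ 2) For every $h\in\mathfrak{h}$, the automorphism group of the Heisenberg vertex operator algebra $(V_{\widehat{\mathfrak{h}}}(1,0),\omega_h)$ is $$\mathrm{Aut}_{VOA}(V_{\widehat{\mathfrak{h}}}(1,0),\omega_h)=\{\sigma\in \mathrm{O}(\mathfrak{h})\mid\sigma(h)=h\},$$ the isotropy subgroup $\mathrm{O}(\mathfrak{h})_h$ of $h$ in $\mathrm{O}(\mathfrak{h})$. In particular, for $h=0$, $\mathrm{Aut}_{VOA}(V_{\widehat{\mathfrak{h}}}(1,0),\omega_0)=\mathrm{Aut}(\mathfrak{h},\langle\cdot,\cdot\rangle)\cong\mathrm{O}(\mathfrak{h})$.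
   Context: Everything is over $\mathbb{C}$. Put $d=\dim\mathfrak{h}$. $\widehat{\mathfrak{h}}=\mathbb{C}[t,t^{-1}]\otimes\mathfrak{h}\oplus\mathbb{C}C$ is the Lie algebra with $C$ central and $[u\otimes t^m,v\otimes t^n]=m\langle u,v\rangle\delta_{m,-n}C$. $V_{\widehat{\mathfrak{h}}}(1,0)=U(\widehat{\mathfrak{h}})\otimes_{U(\widehat{\mathfrak{h}}^{\geq 0})}\mathbb{C}\mathbf{1}$, where $\widehat{\mathfrak{h}}^{\ge 0}=\mathbb{C}[t]\otimes\mathfrak{h}\oplus\mathbb{C}C$ acts on $\mathbb{C}\mathbf{1}$ with $\mathbb{C}[t]\otimes\mathfrak{h}$ acting by $0$ and $C$ by $1$. Write $u(n)$ for the action of $u\otimes t^n$. It has a unique vertex algebra structure with vacuum $\mathbf{1}$ and $Y(u(-1)\mathbf{1},z)=\sum_{n\in\mathbb{Z}}u(n)z^{-n-1}$ for $u\in\mathfrak{h}$. The standard gradation is $V_{\widehat{\mathfrak{h}}}(1,0)=\bigoplus_{n\ge0}V_{\widehat{\mathfrak{h}}}(1,0)_n$, where $V_{\widehat{\mathfrak{h}}}(1,0)_n$ is spanned by the $u_1(-n_1)\cdots u_k(-n_k)\mathbf{1}$ with $k\ge 0$, $u_i\in\mathfrak{h}$, $n_i\ge1$, $\sum n_i=n$. $\mathfrak{h}$ is identified with $V_{\widehat{\mathfrak{h}}}(1,0)_1$ via $u\mapsto u(-1)\mathbf{1}$. For $h\in\mathfrak{h}$ and an orthonormal basis $h_1,\dots,h_d$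 of $\mathfrak{h}$, $\omega_h=\frac12\sum_{i=1}^d h_i(-1)^2\mathbf{1}+h(-2)\mathbf{1}$; it is a conformal vector whose conformal gradation is the standard gradation. A vertex algebra automorphism is a linear bijection $\sigma$ with $\sigma(\mathbf{1})=\mathbf{1}$ and $\sigma(Y(u,z)v)=Y(\sigma u,z)\sigma v$; a vertex operator algebra automorphism in addition fixes the conformal vector. *)

theory Defs
  imports Complex_Main "HOL-Library.Poly_Mapping" "HOL-Library.Groups_Big_Fun" "HOL-Algebra.Group"
begin

section \<open>Complex vector spaces with a nondegenerate symmetric bilinear form\<close>

class complex_vector = ab_group_add +
  fixes scaleC :: "complex \<Rightarrow> 'a \<Rightarrow> 'a"  (infixr \<open>*\<^sub>C\<close> 75)
  assumes scaleC_add_right: "a *\<^sub>C (x + y) = a *\<^sub>C x + a *\<^sub>C y"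
    and scaleC_add_left: "(a + b) *\<^sub>C x = a *\<^sub>C x + b *\<^sub>C x"
    and scaleC_scaleC: "a *\<^sub>C b *\<^sub>C x = (a * b) *\<^sub>C x"
    and scaleC_one: "1 *\<^sub>C x = x"

interpretation cvs: vector_space "scaleC :: complex \<Rightarrow> 'a \<Rightarrow> 'a::complex_vector"
  by unfold_locales (simp_all add: scaleC_add_right scaleC_add_left scaleC_scaleC scaleC_one)

abbreviation clinear :: "('a::complex_vector \<Rightarrow> 'b::complex_vector) \<Rightarrow> bool" where
  "clinear \<equiv> Vector_Spaces.linear scaleC scaleC"

text \<open>
  The class of finite-dimensional spaces carrying a form. Dimension zero is allowed.
  A statement about an arbitrary type of this class is a statement about an arbitrary
  pair of a space and a form.
\<close>

class formed_space = complex_vector +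
  fixes form :: "'a \<Rightarrow> 'a \<Rightarrow> complex"
  assumes finite_dimensional: "\<exists>B. finite B \<and> (\<forall>x. \<exists>c. x = (\<Sum>b\<in>B. c b *\<^sub>C b))"
    and form_sym: "form x y = form y x"
    and form_add_left: "form (x + y) z = form x z + form y z"
    and form_scale_left: "form (c *\<^sub>C x) z = c * form x z"
    and form_nondegenerate: "(\<And>y. form x y = 0) \<Longrightarrow> x = 0"
begin

lemma form_add_right: "form z (x + y) = form z x + form z y"
  by (metis form_add_left form_sym)

lemma form_scale_right: "form z (c *\<^sub>C x) = c * form z x"
  by (metis form_scale_left form_sym)

lemma form_zero_left [simp]: "form 0 z = 0"
  using form_add_left[of 0 0 z] by simp

lemma form_zero_right [simp]: "form z 0 = 0"
  by (metis form_zero_left form_sym)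

end

definition orthonormal_basis :: "'h::formed_space list \<Rightarrow> bool" where
  "orthonormal_basis bs \<longleftrightarrow>
     distinct bs \<and> cvs.independent (set bs) \<and> cvs.span (set bs) = UNIV \<and>
     (\<forall>i<length bs. \<forall>j<length bs. form (bs ! i) (bs ! j) = (if i = j then 1 else 0))"

section \<open>Lie algebras and their universal enveloping algebras\<close>

class lie_algebra = complex_vector +
  fixes bracket :: "'a \<Rightarrow> 'a \<Rightarrow> 'a"
  assumes bracket_add_left: "bracket (x + y) z = bracket x z + bracket y z"
    and bracket_add_right: "bracket z (x + y) = bracket z x + bracket z y"
    and bracket_scale_left: "bracket (c *\<^sub>C x) z = c *\<^sub>C bracket x z"
    and bracket_scale_right: "bracket z (c *\<^sub>C x) = c *\<^sub>C bracket z x"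
    and bracket_self: "bracket x x = 0"
    and jacobi: "bracket x (bracket y z) + bracket y (bracket z x) + bracket z (bracket x y) = 0"

text \<open>
  The free monoid, written additively so that \<open>'g word \<Rightarrow>\<^sub>0 complex\<close> with the
  convolution product of \<^theory>\<open>HOL-Library.Poly_Mapping\<close> is the free associative
  algebra on the set of all elements of \<^typ>\<open>'g\<close>.
\<close>

datatype 'g word = Word (letters: "'g list")

instantiation word :: (type) monoid_add
begin

definition zero_word :: "'a word" where "zero_word = Word []"

definition plus_word :: "'a word \<Rightarrow> 'a word \<Rightarrow> 'a word" where
  "plus_word v w = Word (letters v @ letters w)"

instance by standard (simp_all add: zero_word_def plus_word_def)

end

type_synonym 'g free_algebra = "'g word \<Rightarrow>\<^sub>0 complex"

definition fa_gen :: "'g \<Rightarrow> 'g free_algebra" where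
  "fa_gen x = Poly_Mapping.single (Word [x]) 1"

definition fa_const :: "complex \<Rightarrow> 'g free_algebra" where
  "fa_const c = Poly_Mapping.single 0 c"

text \<open>
  The first two families of relations cut the free algebra on the set \<^typ>\<open>'g\<close> down to the
  tensor algebra of the vector space \<^typ>\<open>'g\<close>.
\<close>

inductive_set uea_ideal :: "'g::lie_algebra free_algebra set" where
  rel_add: "fa_gen (x + y) - fa_gen x - fa_gen y \<in> uea_ideal"
| rel_scale: "fa_gen (c *\<^sub>C x) - fa_const c * fa_gen x \<in> uea_ideal"
| rel_bracket: "fa_gen x * fa_gen y - fa_gen y * fa_gen x - fa_gen (bracket x y) \<in> uea_ideal"
| ideal_add: "p \<in> uea_ideal \<Longrightarrow> q \<in> uea_ideal \<Longrightarrow> p + q \<in> uea_ideal"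
| ideal_mult: "p \<in> uea_ideal \<Longrightarrow> a * p * b \<in> uea_ideal"

lemma uea_ideal_zero: "0 \<in> uea_ideal"
  using ideal_mult[OF rel_add, of 0 _ _ 0] by simp

lemma uea_ideal_uminus: "p \<in> uea_ideal \<Longrightarrow> - p \<in> uea_ideal"
  using ideal_mult[of p "- 1" 1] by simp

lemma uea_ideal_minus: "p \<in> uea_ideal \<Longrightarrow> q \<in> uea_ideal \<Longrightarrow> p - q \<in> uea_ideal"
  using ideal_add[of p "- q"] uea_ideal_uminus[of q] by simp

lemma uea_ideal_mult_left: "p \<in> uea_ideal \<Longrightarrow> a * p \<in> uea_ideal"
  using ideal_mult[of p a 1] by simp

lemma uea_ideal_mult_right: "p \<in> uea_ideal \<Longrightarrow> p * a \<in> uea_ideal"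
  using ideal_mult[of p 1 a] by simp

definition uea_cong :: "'g::lie_algebra free_algebra \<Rightarrow> 'g free_algebra \<Rightarrow> bool" where
  "uea_cong p q \<longleftrightarrow> p - q \<in> uea_ideal"

lemma equivp_uea_cong: "equivp (uea_cong :: 'g::lie_algebra free_algebra \<Rightarrow> _)"
proof (rule equivpI)
  show "reflp uea_cong" by (simp add: reflp_def uea_cong_def uea_ideal_zero)
  show "symp (uea_cong :: 'g free_algebra \<Rightarrow> _)"
  proof (rule sympI)
    fix p q :: "'g free_algebra"
    assume "uea_cong p q"
    then have "- (p - q) \<in> uea_ideal"
      unfolding uea_cong_def by (rule uea_ideal_uminus)
    then show "uea_cong q p" by (simp add: uea_cong_def)
  qed
  show "transp (uea_cong :: 'g free_algebra \<Rightarrow> _)"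
  proof (rule transpI)
    fix p q r :: "'g free_algebra"
    assume "uea_cong p q" "uea_cong q r"
    then have "(p - q) + (q - r) \<in> uea_ideal"
      unfolding uea_cong_def by (rule ideal_add)
    then show "uea_cong p r" by (simp add: uea_cong_def)
  qed
qed

quotient_type (overloaded) 'g uea = "'g::lie_algebra free_algebra" / uea_cong
  by (rule equivp_uea_cong)

instantiation uea :: (lie_algebra) "{ring, monoid_mult, complex_vector}"
begin

lift_definition zero_uea :: "'a uea" is 0 .
lift_definition one_uea :: "'a uea" is 1 .

lift_definition plus_uea :: "'a uea \<Rightarrow> 'a uea \<Rightarrow> 'a uea" is "(+)"
proof -
  fix p p' q q' :: "'a free_algebra"
  assume "uea_cong p p'" "uea_cong q q'"
  then have "(p - p') + (q - q') \<in> uea_ideal"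
    unfolding uea_cong_def by (rule ideal_add)
  then show "uea_cong (p + q) (p' + q')"
    by (simp add: uea_cong_def algebra_simps)
qed

lift_definition uminus_uea :: "'a uea \<Rightarrow> 'a uea" is uminus
proof -
  fix p p' :: "'a free_algebra"
  assume "uea_cong p p'"
  then have "- (p - p') \<in> uea_ideal"
    unfolding uea_cong_def by (rule uea_ideal_uminus)
  then show "uea_cong (- p) (- p')"
    by (simp add: uea_cong_def)
qed

lift_definition minus_uea :: "'a uea \<Rightarrow> 'a uea \<Rightarrow> 'a uea" is "(-)"
proof -
  fix p p' q q' :: "'a free_algebra"
  assume "uea_cong p p'" "uea_cong q q'"
  then have "(p - p') - (q - q') \<in> uea_ideal"
    unfolding uea_cong_def by (rule uea_ideal_minus)
  then show "uea_cong (p - q) (p' - q')"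
    by (simp add: uea_cong_def algebra_simps)
qed

lift_definition times_uea :: "'a uea \<Rightarrow> 'a uea \<Rightarrow> 'a uea" is "(*)"
proof -
  fix p p' q q' :: "'a free_algebra"
  assume "uea_cong p p'" "uea_cong q q'"
  then have "(p - p') * q + p' * (q - q') \<in> uea_ideal"
    unfolding uea_cong_def by (intro ideal_add uea_ideal_mult_left uea_ideal_mult_right)
  then show "uea_cong (p * q) (p' * q')"
    by (simp add: uea_cong_def algebra_simps)
qed

lift_definition scaleC_uea :: "complex \<Rightarrow> 'a uea \<Rightarrow> 'a uea" is "\<lambda>c p. fa_const c * p"
  by (simp add: uea_cong_def uea_ideal_mult_left flip: right_diff_distrib)

instance
proof
  fix a b :: complex and x y z :: "'a uea"
  show "x + y + z = x + (y + z)" "x + y = y + x" "0 + x = x" "- x + x = 0" "x - y = x + - y"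
    "x * y * z = x * (y * z)" "(x + y) * z = x * z + y * z" "x * (y + z) = x * y + x * z"
    "1 * x = x" "x * 1 = x"
    by (transfer; simp add: uea_cong_def uea_ideal_zero algebra_simps)+
  show "a *\<^sub>C (x + y) = a *\<^sub>C x + a *\<^sub>C y"
    by (transfer; simp add: uea_cong_def uea_ideal_zero algebra_simps)
  show "(a + b) *\<^sub>C x = a *\<^sub>C x + b *\<^sub>C x"
    by (transfer; simp add: uea_cong_def uea_ideal_zero fa_const_def single_add algebra_simps)
  show "a *\<^sub>C b *\<^sub>C x = (a * b) *\<^sub>C x"
    by (transfer; simp add: uea_cong_def uea_ideal_zero fa_const_def mult_single
        flip: mult.assoc)
  show "1 *\<^sub>C x = x"
    by (transfer; simp add: uea_cong_def uea_ideal_zero fa_const_def)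
qed

end

lift_definition uea_of :: "'g::lie_algebra \<Rightarrow> 'g uea" is fa_gen .

section \<open>The affine Lie algebra of a space with a form\<close>

text \<open>
  A Laurent polynomial with coefficients in \<^typ>\<open>'h\<close> is a finitely supported function on the
  integers, so \<open>Affine f c\<close> is the sum of all \<open>f(m) \<otimes> t^m\<close> and \<open>c\<close> times
  the central element.
\<close>

declare [[typedef_overloaded]]

datatype ('h::zero) affine = Affine (loop_part: "int \<Rightarrow>\<^sub>0 'h") (central_part: complex)

instantiation affine :: (complex_vector) complex_vector
begin

definition zero_affine :: "'a affine" where
  "zero_affine = Affine 0 0"
definition plus_affine :: "'a affine \<Rightarrow> 'a affine \<Rightarrow> 'a affine" where
  "plus_affine x y = Affine (loop_part x + loop_part y) (central_part x + central_part y)"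
definition uminus_affine :: "'a affine \<Rightarrow> 'a affine" where
  "uminus_affine x = Affine (- loop_part x) (- central_part x)"
definition minus_affine :: "'a affine \<Rightarrow> 'a affine \<Rightarrow> 'a affine" where
  "minus_affine x y = Affine (loop_part x - loop_part y) (central_part x - central_part y)"
definition scaleC_affine :: "complex \<Rightarrow> 'a affine \<Rightarrow> 'a affine" where
  "scaleC_affine c x = Affine (Poly_Mapping.map (scaleC c) (loop_part x)) (c * central_part x)"

lemma lookup_map_scaleC [simp]:
  "Poly_Mapping.lookup (Poly_Mapping.map (scaleC c) f) m = c *\<^sub>C Poly_Mapping.lookup f m"
  by (simp add: Poly_Mapping.map.rep_eq when_def)

instance
proof
  fix a b :: complex and x y z :: "'a affine"
  show "x + y + z = x + (y + z)" "x + y = y + x" "0 + x = x" "- x + x = 0" "x - y = x + - y"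
    by (simp_all add: zero_affine_def plus_affine_def uminus_affine_def minus_affine_def
        algebra_simps)
  show "a *\<^sub>C (x + y) = a *\<^sub>C x + a *\<^sub>C y" "(a + b) *\<^sub>C x = a *\<^sub>C x + b *\<^sub>C x"
    "a *\<^sub>C b *\<^sub>C x = (a * b) *\<^sub>C x" "1 *\<^sub>C x = x"
    by (auto simp: plus_affine_def scaleC_affine_def lookup_add algebra_simps
        scaleC_add_right scaleC_add_left scaleC_scaleC scaleC_one
        intro!: affine.expand poly_mapping_eqI)
qed

end

text \<open>The bilinear extension of \<open>[u \<otimes> t^m, v \<otimes> t^n] = m \<langle>u, v\<rangle> \<delta>_(m,-n) C\<close>.\<close>

definition affine_cocycle :: "(int \<Rightarrow>\<^sub>0 'h::formed_space) \<Rightarrow> (int \<Rightarrow>\<^sub>0 'h) \<Rightarrow> complex" where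
  "affine_cocycle f g =
     (\<Sum>m\<in>Poly_Mapping.keys f. of_int m * form (Poly_Mapping.lookup f m) (Poly_Mapping.lookup g (- m)))"

lemma affine_cocycle_superset:
  assumes "finite A" "Poly_Mapping.keys f \<subseteq> A"
  shows "affine_cocycle f g =
    (\<Sum>m\<in>A. of_int m * form (Poly_Mapping.lookup f m) (Poly_Mapping.lookup g (- m)))"
  unfolding affine_cocycle_def
  by (rule sum.mono_neutral_left) (use assms in \<open>auto simp: in_keys_iff\<close>)

lemma affine_cocycle_self: "affine_cocycle f f = 0"
proof -
  define A where "A = Poly_Mapping.keys f \<union> uminus ` Poly_Mapping.keys f"
  have A: "finite A" "Poly_Mapping.keys f \<subseteq> A" by (auto simp: A_def)
  have "affine_cocycle f f =
      (\<Sum>m\<in>A. of_int (- m) * form (Poly_Mapping.lookup f (- m)) (Poly_Mapping.lookup f m))"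
    unfolding affine_cocycle_superset[OF A]
    by (rule sum.reindex_bij_witness[of _ uminus uminus]) (auto simp: A_def)
  also have "\<dots> = - affine_cocycle f f"
    unfolding affine_cocycle_superset[OF A] by (simp add: sum_negf form_sym)
  finally show ?thesis by simp
qed

lemma affine_cocycle_add_left:
  "affine_cocycle (f + g) k = affine_cocycle f k + affine_cocycle g k"
proof -
  have A: "finite (Poly_Mapping.keys f \<union> Poly_Mapping.keys g)" by simp
  show ?thesis
    unfolding affine_cocycle_superset[OF A Poly_Mapping.keys_add]
      affine_cocycle_superset[OF A Un_upper1] affine_cocycle_superset[OF A Un_upper2]
    by (simp add: lookup_add form_add_left distrib_left sum.distrib)
qed

instantiation affine :: (formed_space) lie_algebra
begin

definition bracket_affine :: "'a affine \<Rightarrow> 'a affine \<Rightarrow> 'a affine" where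
  "bracket_affine x y = Affine 0 (affine_cocycle (loop_part x) (loop_part y))"

instance
proof
  fix c :: complex and x y z :: "'a affine"
  show "bracket (x + y) z = bracket x z + bracket y z"
    by (simp add: bracket_affine_def plus_affine_def affine_cocycle_add_left)
  show "bracket z (x + y) = bracket z x + bracket z y"
    by (simp add: bracket_affine_def plus_affine_def affine_cocycle_def lookup_add
        form_add_right distrib_left sum.distrib)
  have "Poly_Mapping.keys (Poly_Mapping.map (scaleC c) (loop_part x)) \<subseteq> Poly_Mapping.keys (loop_part x)"
    by (auto simp: in_keys_iff)
  then show "bracket (c *\<^sub>C x) z = c *\<^sub>C bracket x z"
    by (auto simp: bracket_affine_def scaleC_affine_def form_scale_left sum_distrib_left
        affine_cocycle_superset[of "Poly_Mapping.keys (loop_part x)"] algebra_simps intro!: poly_mapping_eqI)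
  show "bracket z (c *\<^sub>C x) = c *\<^sub>C bracket z x"
    by (auto simp: bracket_affine_def scaleC_affine_def affine_cocycle_def form_scale_right
        sum_distrib_left algebra_simps intro!: poly_mapping_eqI)
  show "bracket x x = 0"
    by (simp add: bracket_affine_def zero_affine_def affine_cocycle_self)
  show "bracket x (bracket y z) + bracket y (bracket z x) + bracket z (bracket x y) = 0"
    by (simp add: bracket_affine_def plus_affine_def zero_affine_def affine_cocycle_def)
qed

end

definition affine_nonneg :: "'h::zero affine set" where
  "affine_nonneg = {x. \<forall>m<0. Poly_Mapping.lookup (loop_part x) m = 0}"

section \<open>The induced module\<close>

text \<open>
  On the one-dimensional module of the nonnegative part, \<open>x\<close> acts by the scalar
  \<^term>\<open>central_part x\<close>: positive and zero modes act by \<open>0\<close> and the central element by \<open>1\<close>.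
  The tensor product with this module over the enveloping algebra of the nonnegative part is the
  quotient of the enveloping algebra \<open>U\<close> by the relations
  \<open>a x \<otimes> 1 = a \<otimes> x 1\<close>, where \<open>x\<close> may be restricted to the algebra
  generators \<^term>\<open>affine_nonneg\<close>.
\<close>

definition balancing_relations :: "'h::formed_space affine uea set" where
  "balancing_relations =
     cvs.span {a * uea_of x - central_part x *\<^sub>C a | a x. x \<in> affine_nonneg}"

lemma scaleC_uea_mult_left: "(c *\<^sub>C a) * b = c *\<^sub>C (a * b)" for a b :: "'g::lie_algebra uea"
  by (transfer; simp add: uea_cong_def uea_ideal_zero mult.assoc)

lemma single_zero_mult_commute:
  "Poly_Mapping.single 0 c * p = p * Poly_Mapping.single 0 c"
  for p :: "'g free_algebra"
proof (induction p rule: Poly_Mapping.update_induct)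
  case const
  then show ?case by simp
next
  case (update f k v)
  then have "Poly_Mapping.update k v f = f + Poly_Mapping.single k v"
    by (intro poly_mapping_eqI)
       (auto simp: Poly_Mapping.lookup_update lookup_add lookup_single when_def in_keys_iff)
  with update.IH show ?case
    by (simp add: distrib_left distrib_right mult_single mult.commute)
qed

lemma scaleC_uea_mult_right: "a * (c *\<^sub>C b) = c *\<^sub>C (a * b)" for a b :: "'g::lie_algebra uea"
proof (transfer)
  fix a b :: "'g free_algebra" and c
  have "a * (fa_const c * b) = fa_const c * (a * b)"
    unfolding fa_const_def by (metis mult.assoc single_zero_mult_commute)
  then show "uea_cong (a * (fa_const c * b)) (fa_const c * (a * b))"
    by (simp add: uea_cong_def uea_ideal_zero)
qed

lemma balancing_relations_mult_left:
  assumes "r \<in> balancing_relations"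
  shows "a * r \<in> balancing_relations"
  using assms unfolding balancing_relations_def
proof (induction rule: cvs.span_induct_alt)
  case base
  then show ?case by (simp add: cvs.span_zero)
next
  case (step c r s)
  then obtain b x where r: "r = b * uea_of x - central_part x *\<^sub>C b" "x \<in> affine_nonneg"
    by blast
  have "a * r = (a * b) * uea_of x - central_part x *\<^sub>C (a * b)"
    by (simp add: r(1) right_diff_distrib mult.assoc scaleC_uea_mult_right)
  then have "a * r \<in> {a * uea_of x - central_part x *\<^sub>C a | a x. x \<in> affine_nonneg}"
    using r(2) by blast
  with step.IH show ?case
    by (simp add: distrib_left scaleC_uea_mult_right cvs.span_add cvs.span_scale cvs.span_base)
qed

definition heis_cong :: "'h::formed_space affine uea \<Rightarrow> 'h affine uea \<Rightarrow> bool" where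
  "heis_cong a b \<longleftrightarrow> a - b \<in> balancing_relations"

lemma equivp_heis_cong: "equivp (heis_cong :: 'h::formed_space affine uea \<Rightarrow> _)"
proof (rule equivpI)
  show "reflp heis_cong"
    by (simp add: reflp_def heis_cong_def balancing_relations_def cvs.span_zero)
  show "symp (heis_cong :: 'h affine uea \<Rightarrow> _)"
  proof (rule sympI)
    fix p q :: "'h affine uea"
    assume "heis_cong p q"
    then have "- (p - q) \<in> balancing_relations"
      unfolding heis_cong_def balancing_relations_def by (rule cvs.span_neg)
    then show "heis_cong q p" by (simp add: heis_cong_def)
  qed
  show "transp (heis_cong :: 'h affine uea \<Rightarrow> _)"
  proof (rule transpI)
    fix p q r :: "'h affine uea"
    assume "heis_cong p q" "heis_cong q r"
    then have "(p - q) + (q - r) \<in> balancing_relations"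
      unfolding heis_cong_def balancing_relations_def by (rule cvs.span_add)
    then show "heis_cong p r" by (simp add: heis_cong_def)
  qed
qed

quotient_type (overloaded) 'h heis = "'h::formed_space affine uea" / heis_cong
  by (rule equivp_heis_cong)

instantiation heis :: (formed_space) complex_vector
begin

lift_definition zero_heis :: "'a heis" is 0 .

lift_definition plus_heis :: "'a heis \<Rightarrow> 'a heis \<Rightarrow> 'a heis" is "(+)"
proof -
  fix p p' q q' :: "'a affine uea"
  assume "heis_cong p p'" "heis_cong q q'"
  then have "(p - p') + (q - q') \<in> balancing_relations"
    unfolding heis_cong_def balancing_relations_def by (rule cvs.span_add)
  then show "heis_cong (p + q) (p' + q')"
    by (simp add: heis_cong_def algebra_simps)
qed

lift_definition uminus_heis :: "'a heis \<Rightarrow> 'a heis" is uminus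
proof -
  fix p p' :: "'a affine uea"
  assume "heis_cong p p'"
  then have "- (p - p') \<in> balancing_relations"
    unfolding heis_cong_def balancing_relations_def by (rule cvs.span_neg)
  then show "heis_cong (- p) (- p')"
    by (simp add: heis_cong_def)
qed

lift_definition minus_heis :: "'a heis \<Rightarrow> 'a heis \<Rightarrow> 'a heis" is "(-)"
proof -
  fix p p' q q' :: "'a affine uea"
  assume "heis_cong p p'" "heis_cong q q'"
  then have "(p - p') - (q - q') \<in> balancing_relations"
    unfolding heis_cong_def balancing_relations_def by (rule cvs.span_diff)
  then show "heis_cong (p - q) (p' - q')"
    by (simp add: heis_cong_def algebra_simps)
qed

lift_definition scaleC_heis :: "complex \<Rightarrow> 'a heis \<Rightarrow> 'a heis" is scaleC
  by (simp add: heis_cong_def balancing_relations_def cvs.span_scale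
      flip: cvs.scale_right_diff_distrib)

instance
proof
  fix a b :: complex and x y z :: "'a heis"
  show "x + y + z = x + (y + z)" "x + y = y + x" "0 + x = x" "- x + x = 0" "x - y = x + - y"
    "a *\<^sub>C (x + y) = a *\<^sub>C x + a *\<^sub>C y" "(a + b) *\<^sub>C x = a *\<^sub>C x + b *\<^sub>C x"
    "a *\<^sub>C b *\<^sub>C x = (a * b) *\<^sub>C x" "1 *\<^sub>C x = x"
    by (transfer; simp add: heis_cong_def balancing_relations_def cvs.span_zero algebra_simps
        scaleC_add_right scaleC_add_left scaleC_scaleC scaleC_one)+
qed

end

definition uea_act :: "'h::formed_space affine uea \<Rightarrow> 'h heis \<Rightarrow> 'h heis" where
  "uea_act a w = abs_heis (a * rep_heis w)"

lemma uea_act_abs: "uea_act a (abs_heis b) = abs_heis (a * b)"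
proof -
  have "heis_cong (rep_heis (abs_heis b)) b"
    by (rule Quotient3_rep_abs[OF Quotient3_heis]) (simp add: heis_cong_def
        balancing_relations_def cvs.span_zero)
  then have "heis_cong (a * rep_heis (abs_heis b)) (a * b)"
    by (simp add: heis_cong_def balancing_relations_mult_left flip: right_diff_distrib)
  then show ?thesis
    by (simp add: uea_act_def heis.abs_eq_iff)
qed

lift_definition vacuum :: "'h::formed_space heis" is 1 .

text \<open>\<open>hmode u n\<close> is \<open>u(n)\<close>, the action of \<open>u \<otimes> t^n\<close>.\<close>

definition hmode :: "'h::formed_space \<Rightarrow> int \<Rightarrow> 'h heis \<Rightarrow> 'h heis" where
  "hmode u n = uea_act (uea_of (Affine (Poly_Mapping.single n u) 0))"

definition heis_grade :: "nat \<Rightarrow> 'h::formed_space heis set" where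
  "heis_grade n = cvs.span
     {foldr (\<lambda>(u, m). hmode u (- int m)) us vacuum | us.
        (\<forall>(u, m) \<in> set us. 1 \<le> m) \<and> sum_list (map snd us) = n}"

definition embed :: "'h::formed_space \<Rightarrow> 'h heis" where
  "embed u = hmode u (- 1) vacuum"

definition omega :: "'h::formed_space list \<Rightarrow> 'h \<Rightarrow> 'h heis" where
  "omega bs h = (1 / 2) *\<^sub>C (\<Sum>b\<leftarrow>bs. hmode b (- 1) (hmode b (- 1) vacuum)) + hmode h (- 2) vacuum"

section \<open>Vertex algebras and their automorphisms\<close>

text \<open>
  \<open>Y u n v\<close> is \<open>u_n v\<close>, the coefficient of \<open>z^(-n-1)\<close> in \<open>Y(u,z)v\<close>. The last axiom is the
  Jacobi identity in its component form (the Borcherds identity). By truncation both of its sums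
  have finite support.
\<close>

locale vertex_algebra =
  fixes vac :: "'v::complex_vector" and Y :: "'v \<Rightarrow> int \<Rightarrow> 'v \<Rightarrow> 'v"
  assumes Y_linear_left: "clinear (\<lambda>u. Y u n v)"
    and Y_linear_right: "clinear (Y u n)"
    and truncation: "\<exists>N. \<forall>n\<ge>N. Y u n v = 0"
    and vacuum_left: "Y vac n v = (if n = - 1 then v else 0)"
    and creation_regular: "0 \<le> n \<Longrightarrow> Y u n vac = 0"
    and creation_value: "Y u (- 1) vac = u"
    and borcherds:
      "Sum_any (\<lambda>i::nat. (of_int m gchoose i) *\<^sub>C Y (Y u (n + int i) v) (m + k - int i) w) =
       Sum_any (\<lambda>i::nat. ((- 1) ^ i * (of_int n gchoose i)) *\<^sub>C
          (Y u (m + n - int i) (Y v (k + int i) w)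
           - ((- 1) powi n) *\<^sub>C Y v (n + k - int i) (Y u (m + int i) w)))"

definition va_automorphism ::
    "'v::complex_vector \<Rightarrow> ('v \<Rightarrow> int \<Rightarrow> 'v \<Rightarrow> 'v) \<Rightarrow> ('v \<Rightarrow> 'v) \<Rightarrow> bool" where
  "va_automorphism vac Y \<sigma> \<longleftrightarrow>
     clinear \<sigma> \<and> bij \<sigma> \<and> \<sigma> vac = vac \<and> (\<forall>u n v. \<sigma> (Y u n v) = Y (\<sigma> u) n (\<sigma> v))"

definition map_group :: "('a \<Rightarrow> 'a) set \<Rightarrow> ('a \<Rightarrow> 'a) monoid" where
  "map_group S = \<lparr>carrier = S, monoid.mult = (\<circ>), one = id\<rparr>"

definition graded_va_aut ::
    "'v::complex_vector \<Rightarrow> ('v \<Rightarrow> int \<Rightarrow> 'v \<Rightarrow> 'v) \<Rightarrow> (nat \<Rightarrow> 'v set) \<Rightarrow> ('v \<Rightarrow> 'v) monoid" where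
  "graded_va_aut vac Y G = map_group {\<sigma>. va_automorphism vac Y \<sigma> \<and> (\<forall>n. \<sigma> ` G n = G n)}"

definition voa_aut ::
    "'v::complex_vector \<Rightarrow> ('v \<Rightarrow> int \<Rightarrow> 'v \<Rightarrow> 'v) \<Rightarrow> 'v \<Rightarrow> ('v \<Rightarrow> 'v) monoid" where
  "voa_aut vac Y \<omega> = map_group {\<sigma>. va_automorphism vac Y \<sigma> \<and> \<sigma> \<omega> = \<omega>}"

definition orthogonal_group :: "('h::formed_space \<Rightarrow> 'h) monoid" where
  "orthogonal_group =
     map_group {g. clinear g \<and> bij g \<and> (\<forall>u v. form (g u) (g v) = form u v)}"

definition isotropy_group :: "'h::formed_space \<Rightarrow> ('h \<Rightarrow> 'h) monoid" where
  "isotropy_group h = map_group {g \<in> carrier orthogonal_group. g h = h}"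

section \<open>The Heisenberg vertex algebra\<close>

definition heisenberg_vertex_structure ::
    "('h::formed_space heis \<Rightarrow> int \<Rightarrow> 'h heis \<Rightarrow> 'h heis) \<Rightarrow> bool" where
  "heisenberg_vertex_structure Y \<longleftrightarrow>
     vertex_algebra vacuum Y \<and> (\<forall>u n. Y (embed u) n = hmode u n)"

text \<open>The restriction of \<open>\<sigma>\<close> to the degree one part, read through \<^const>\<open>embed\<close>.\<close>

definition restrict_to_h :: "('h::formed_space heis \<Rightarrow> 'h heis) \<Rightarrow> 'h \<Rightarrow> 'h" where
  "restrict_to_h \<sigma> = inv_into UNIV embed \<circ> \<sigma> \<circ> embed"

end

theory Submission
  imports Defs "HOL-Library.Function_Algebras"
begin

text \<open>
  Write \<open>V\<close> for the induced module. Three facts about it carry the proof. It is universal: a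
  Heisenberg module together with a vector annihilated by all modes of nonnegative index receives a
  unique homomorphism from \<open>V\<close> that sends the vacuum to that vector (locale
  \<open>heisenberg_module\<close>). It is cyclic: a subspace that contains the vacuum and is stable under all modes
  \<open>u(n)\<close> is everything (\<open>heis_generated\<close>). And its vacuum is not zero, since
  the universal property maps it to \<open>1\<close> in a module of power series
  (\<open>vacuum_nonzero\<close>).

  Restricting a graded automorphism \<open>\<sigma>\<close> to degree one gives a linear bijection \<open>g\<close>. Since
  \<open>u(1) v(- 1) 1 = \<langle>u, v\<rangle> 1\<close> and the vacuum is nonzero, \<open>g\<close> is an isometry, and by cyclicity \<open>g\<close>
  determines \<open>\<sigma>\<close>. Conversely an isometry \<open>g\<close> lifts to \<open>V\<close> by universality, because the modes
  \<open>(g u)(n)\<close> satisfy the same relations as the \<open>u(n)\<close>. The lift respects all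
  products because it respects those with the generators \<open>u(- 1) 1\<close>, and the Borcherds identity expresses
  the modes of \<open>u_n v\<close> through those of \<open>u\<close> and \<open>v\<close> (\<open>fock_lift_automorphism\<close>).

  For the conformal vector \<open>\<omega>_h\<close>, the commutator formula shows that its mode \<open>L(0)\<close> of index \<open>1\<close>
  satisfies \<open>[L(0), x(m)] = - m x(m)\<close>, whatever \<open>h\<close> is. So the homogeneous subspaces are the
  eigenspaces of \<open>L(0)\<close> (\<open>heis_grade_eigenspace\<close>), and an automorphism fixing \<open>\<omega>_h\<close> is graded.
  It is therefore the lift of an isometry \<open>g\<close>. The quadratic part of \<open>\<omega>_h\<close> is independent of the
  orthonormal basis and hence fixed by the lift, so \<open>\<omega>_h\<close> is fixed if and only if
  \<open>(g h - h)(- 2) 1 = 0\<close>, that is, if and only if \<open>g h = h\<close> (\<open>fock_lift_omega\<close>).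
\<close>

section \<open>Complex-linear maps and the free algebra\<close>

lemma clinearI:
  assumes "\<And>x y. f (x + y) = f x + f y" "\<And>c x. f (c *\<^sub>C x) = c *\<^sub>C f x"
  shows "clinear f"
  using assms by (simp add: Vector_Spaces.linear_iff cvs.vector_space_axioms)

lemma
  assumes "clinear f"
  shows clinear_add: "f (x + y) = f x + f y"
    and clinear_scale: "f (c *\<^sub>C x) = c *\<^sub>C f x"
    and clinear_zero: "f 0 = 0"
    and clinear_diff: "f (x - y) = f x - f y"
    and clinear_sum: "f (sum g A) = (\<Sum>a\<in>A. f (g a))"
proof -
  interpret Vector_Spaces.linear scaleC scaleC f by fact
  show "f (x + y) = f x + f y" "f (c *\<^sub>C x) = c *\<^sub>C f x" "f 0 = 0" "f (x - y) = f x - f y"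
    "f (sum g A) = (\<Sum>a\<in>A. f (g a))"
    by (rule add scale zero diff sum)+
qed

lemma clinear_compose: "clinear f \<Longrightarrow> clinear g \<Longrightarrow> clinear (\<lambda>x. f (g x))"
  by (rule clinearI) (simp_all add: clinear_add clinear_scale)

lemma clinear_preimage_subspace:
  assumes "clinear f" "cvs.subspace S"
  shows "cvs.subspace {v. f v \<in> S}"
  using assms by (auto simp: cvs.subspace_def clinear_zero clinear_add clinear_scale)

lemma clinear_inverse:
  assumes "clinear f" "bij f"
  shows "clinear (inv_into UNIV f)"
proof (rule clinearI)
  let ?k = "inv_into UNIV f"
  have fk: "f (?k x) = x" and kf: "?k (f y) = y" for x y
    using assms(2) by (simp_all add: bij_is_surj surj_f_inv_f bij_is_inj)
  fix x y and c
  show "?k (x + y) = ?k x + ?k y"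
    using kf[of "?k x + ?k y"] by (simp add: clinear_add[OF assms(1)] fk)
  show "?k (c *\<^sub>C x) = c *\<^sub>C ?k x"
    using kf[of "c *\<^sub>C ?k x"] by (simp add: clinear_scale[OF assms(1)] fk)
qed

lemma clinear_image_span:
  assumes "clinear f"
  shows "f ` cvs.span S = cvs.span (f ` S)"
proof -
  interpret Vector_Spaces.linear scaleC scaleC f by fact
  show ?thesis by (rule span_image[symmetric])
qed

lemma free_algebra_induct [case_names single sum]:
  fixes p :: "'g free_algebra"
  assumes "\<And>a c. P (Poly_Mapping.single a c)" "\<And>p q. P p \<Longrightarrow> P q \<Longrightarrow> P (p + q)"
  shows "P p"
proof (induction p rule: Poly_Mapping.update_induct)
  case const
  then show ?case using assms(1)[of 0 0] by simp
next
  case (update f k v)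
  then have "Poly_Mapping.update k v f = f + Poly_Mapping.single k v"
    by (intro poly_mapping_eqI)
       (auto simp: Poly_Mapping.lookup_update lookup_add lookup_single when_def in_keys_iff)
  with update.IH show ?case by (simp add: assms)
qed

section \<open>The universal property of the induced module\<close>

text \<open>
  A module over the affine Lie algebra on which \<open>C\<close> acts by \<open>1\<close> is the same as a
  family of operators \<open>M u n\<close> satisfying the Heisenberg relations. Together with a vector \<open>m0\<close>
  that all \<open>M u n\<close> with \<open>n \<ge> 0\<close> annihilate, this is exactly what a homomorphism out
  of the induced module amounts to. The homomorphism is obtained by extending the action from the
  Lie algebra to the free algebra, then to its quotient the enveloping algebra, and by
  applying the enveloping algebra to \<open>m0\<close>; each relation divided out acts by zero.
\<close>

locale heisenberg_module =
  fixes M :: "'h::formed_space \<Rightarrow> int \<Rightarrow> 'm::complex_vector \<Rightarrow> 'm" and m0 :: 'm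
  assumes M_add: "M (u + v) n w = M u n w + M v n w"
    and M_scale: "M (c *\<^sub>C u) n w = c *\<^sub>C M u n w"
    and M_linear: "clinear (M u n)"
    and M_commute: "M u m (M v n w) - M v n (M u m w) =
      (if m = - n then of_int m * form u v else 0) *\<^sub>C w"
    and M_vacuum: "0 \<le> n \<Longrightarrow> M u n m0 = 0"
begin

lemma M_zero: "M 0 n w = 0"
  using M_scale[of 0 0 n w] by simp

definition lie_act :: "'h affine \<Rightarrow> 'm \<Rightarrow> 'm" where
  "lie_act x w = central_part x *\<^sub>C w +
     (\<Sum>m\<in>Poly_Mapping.keys (loop_part x). M (Poly_Mapping.lookup (loop_part x) m) m w)"

lemma lie_act_superset:
  assumes "finite A" "Poly_Mapping.keys (loop_part x) \<subseteq> A"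
  shows "lie_act x w = central_part x *\<^sub>C w + (\<Sum>m\<in>A. M (Poly_Mapping.lookup (loop_part x) m) m w)"
proof -
  have "(\<Sum>m\<in>Poly_Mapping.keys (loop_part x). M (Poly_Mapping.lookup (loop_part x) m) m w) =
    (\<Sum>m\<in>A. M (Poly_Mapping.lookup (loop_part x) m) m w)"
    by (rule sum.mono_neutral_left) (use assms in \<open>auto simp: in_keys_iff M_zero\<close>)
  then show ?thesis by (simp add: lie_act_def)
qed

lemma lie_act_mode: "lie_act (Affine (Poly_Mapping.single n u) 0) w = M u n w"
  using lie_act_superset[of "{n}" "Affine (Poly_Mapping.single n u) 0" w] by simp

lemma lie_act_linear: "clinear (lie_act x)"
  by (rule clinearI)
    (simp_all add: lie_act_def clinear_add[OF M_linear] clinear_scale[OF M_linear] sum.distrib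
      scaleC_add_right cvs.scale_sum_right scaleC_scaleC mult.commute)

lemma lie_act_add: "lie_act (x + y) w = lie_act x w + lie_act y w"
proof -
  let ?A = "Poly_Mapping.keys (loop_part x) \<union> Poly_Mapping.keys (loop_part y)"
  have "Poly_Mapping.keys (loop_part (x + y)) \<subseteq> ?A"
    by (simp add: plus_affine_def Poly_Mapping.keys_add)
  then show ?thesis
    using lie_act_superset[of ?A "x + y" w] lie_act_superset[of ?A x w] lie_act_superset[of ?A y w]
    by (simp add: plus_affine_def lookup_add M_add sum.distrib scaleC_add_left)
qed

lemma lie_act_scale: "lie_act (c *\<^sub>C x) w = c *\<^sub>C lie_act x w"
proof -
  let ?A = "Poly_Mapping.keys (loop_part x)"
  have "Poly_Mapping.keys (loop_part (c *\<^sub>C x)) \<subseteq> ?A"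
    by (auto simp: scaleC_affine_def in_keys_iff)
  then show ?thesis
    using lie_act_superset[of ?A "c *\<^sub>C x" w]
    by (simp add: scaleC_affine_def lie_act_def M_scale scaleC_add_right cvs.scale_sum_right
        scaleC_scaleC)
qed

text \<open>
  Expanding both sides into modes leaves the double sum of the commutators of modes, of which only
  the pairs with opposite indices survive; their sum is the cocycle.
\<close>

lemma lie_act_bracket: "lie_act x (lie_act y w) - lie_act y (lie_act x w) = lie_act (bracket x y) w"
proof -
  let ?f = "Poly_Mapping.lookup (loop_part x)" and ?g = "Poly_Mapping.lookup (loop_part y)"
  define A where "A = Poly_Mapping.keys (loop_part x)"
  \<comment> \<open>The keys of the loop part of \<open>y\<close> are enlarged so that every pair \<open>(m, - m)\<close> is summed over.\<close>
  define B where "B = Poly_Mapping.keys (loop_part y) \<union> uminus ` A"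
  have fin: "finite A" "finite B" by (auto simp: A_def B_def)
  have x: "lie_act x v = central_part x *\<^sub>C v + (\<Sum>m\<in>A. M (?f m) m v)" for v
    by (rule lie_act_superset) (use fin in \<open>auto simp: A_def\<close>)
  have y: "lie_act y v = central_part y *\<^sub>C v + (\<Sum>n\<in>B. M (?g n) n v)" for v
    by (rule lie_act_superset) (use fin in \<open>auto simp: B_def\<close>)
  have "lie_act x (lie_act y w) - lie_act y (lie_act x w) =
      (\<Sum>m\<in>A. \<Sum>n\<in>B. M (?f m) m (M (?g n) n w)) - (\<Sum>n\<in>B. \<Sum>m\<in>A. M (?g n) n (M (?f m) m w))"
    by (simp add: x y clinear_add[OF M_linear] clinear_scale[OF M_linear] clinear_sum[OF M_linear]
        sum.distrib scaleC_add_right cvs.scale_sum_right scaleC_scaleC mult.commute)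
  also have "\<dots> = (\<Sum>m\<in>A. \<Sum>n\<in>B. M (?f m) m (M (?g n) n w) - M (?g n) n (M (?f m) m w))"
    by (subst (2) sum.swap) (simp add: sum_subtractf)
  also have "\<dots> = (\<Sum>m\<in>A. \<Sum>n\<in>B. if n = - m then (of_int m * form (?f m) (?g (- m))) *\<^sub>C w else 0)"
    by (intro sum.cong refl) (auto simp: M_commute)
  also have "\<dots> = (\<Sum>m\<in>A. (of_int m * form (?f m) (?g (- m))) *\<^sub>C w)"
    by (intro sum.cong refl) (use fin in \<open>auto simp: sum.delta B_def\<close>)
  also have "\<dots> = lie_act (bracket x y) w"
    by (simp add: lie_act_def bracket_affine_def affine_cocycle_def A_def cvs.scale_sum_left)
  finally show ?thesis .
qed

lemma lie_act_vacuum: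
  assumes "x \<in> affine_nonneg"
  shows "lie_act x m0 = central_part x *\<^sub>C m0"
proof -
  have "M (Poly_Mapping.lookup (loop_part x) m) m m0 = 0" for m
    using assms by (cases "0 \<le> m") (auto simp: affine_nonneg_def M_vacuum M_zero)
  then show ?thesis by (simp add: lie_act_def)
qed

definition word_act :: "'h affine word \<Rightarrow> 'm \<Rightarrow> 'm" where
  "word_act a w = foldr lie_act (letters a) w"

lemma word_act_linear: "clinear (word_act a)"
proof -
  have "clinear (foldr lie_act xs)" for xs
    by (induction xs) (simp_all add: o_def clinear_compose[OF lie_act_linear] clinearI)
  then show ?thesis by (simp add: word_act_def[abs_def])
qed

lemma word_act_plus: "word_act (a + b) w = word_act a (word_act b w)"
  by (simp add: word_act_def plus_word_def)

definition fa_act :: "'h affine free_algebra \<Rightarrow> 'm \<Rightarrow> 'm" where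
  "fa_act p w = (\<Sum>a\<in>Poly_Mapping.keys p. Poly_Mapping.lookup p a *\<^sub>C word_act a w)"

lemma fa_act_superset:
  assumes "finite A" "Poly_Mapping.keys p \<subseteq> A"
  shows "fa_act p w = (\<Sum>a\<in>A. Poly_Mapping.lookup p a *\<^sub>C word_act a w)"
  unfolding fa_act_def by (rule sum.mono_neutral_left) (use assms in \<open>auto simp: in_keys_iff\<close>)

lemma fa_act_linear: "clinear (fa_act p)"
  by (rule clinearI)
    (simp_all add: fa_act_def clinear_add[OF word_act_linear] clinear_scale[OF word_act_linear]
      sum.distrib scaleC_add_right cvs.scale_sum_right scaleC_scaleC mult.commute)

lemma fa_act_add: "fa_act (p + q) w = fa_act p w + fa_act q w"
proof -
  let ?A = "Poly_Mapping.keys p \<union> Poly_Mapping.keys q"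
  show ?thesis
    using fa_act_superset[of ?A "p + q" w] fa_act_superset[of ?A p w] fa_act_superset[of ?A q w]
      Poly_Mapping.keys_add[of p q]
    by (simp add: lookup_add sum.distrib scaleC_add_left)
qed

lemma fa_act_diff: "fa_act (p - q) w = fa_act p w - fa_act q w"
  using fa_act_add[of "p - q" q w] by simp

lemma fa_act_single: "fa_act (Poly_Mapping.single a c) w = c *\<^sub>C word_act a w"
  using fa_act_superset[of "{a}" "Poly_Mapping.single a c" w] by simp

lemma fa_act_mult: "fa_act (p * q) w = fa_act p (fa_act q w)"
proof (induction p rule: free_algebra_induct)
  case (single a c)
  show ?case
  proof (induction q rule: free_algebra_induct)
    case (single b d)
    then show ?case
      by (simp add: mult_single fa_act_single word_act_plus clinear_scale[OF word_act_linear]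
          scaleC_scaleC)
  next
    case (sum q r)
    then show ?case
      by (simp add: distrib_left fa_act_add clinear_add[OF fa_act_linear])
  qed
next
  case (sum p q)
  then show ?case by (simp add: distrib_right fa_act_add)
qed

lemma fa_act_gen: "fa_act (fa_gen x) w = lie_act x w"
  by (simp add: fa_gen_def fa_act_single word_act_def scaleC_one)

lemma fa_act_const: "fa_act (fa_const c) w = c *\<^sub>C w"
  by (simp add: fa_const_def fa_act_single word_act_def zero_word_def)

lemma fa_act_ideal: "p \<in> uea_ideal \<Longrightarrow> fa_act p w = 0"
proof (induction arbitrary: w rule: uea_ideal.induct)
  case (rel_bracket x y)
  then show ?case
    by (simp add: fa_act_diff fa_act_mult fa_act_gen lie_act_bracket)
qed (simp_all add: fa_act_diff fa_act_mult fa_act_gen fa_act_const lie_act_add lie_act_scale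
    fa_act_add clinear_zero[OF fa_act_linear])

definition env_act :: "'h affine uea \<Rightarrow> 'm \<Rightarrow> 'm" where
  "env_act a w = fa_act (rep_uea a) w"

lemma env_act_abs: "env_act (abs_uea p) w = fa_act p w"
proof -
  have "uea_cong (rep_uea (abs_uea p)) p"
    by (rule Quotient3_rep_abs[OF Quotient3_uea]) (simp add: uea_cong_def uea_ideal_zero)
  then show ?thesis
    using fa_act_ideal[of "rep_uea (abs_uea p) - p" w] 
    by (simp add: env_act_def uea_cong_def fa_act_diff)
qed

lemma env_act_diff: "env_act (a - b) w = env_act a w - env_act b w"
  by (induction a rule: uea.abs_induct; induction b rule: uea.abs_induct)
     (simp add: minus_uea.abs_eq env_act_abs fa_act_diff)

lemma env_act_add: "env_act (a + b) w = env_act a w + env_act b w"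
  using env_act_diff[of "a + b" b w] by simp

lemma env_act_scale: "env_act (c *\<^sub>C a) w = c *\<^sub>C env_act a w"
  by (induction a rule: uea.abs_induct)
     (simp add: scaleC_uea.abs_eq env_act_abs fa_act_mult fa_act_const)

lemma env_act_mult: "env_act (a * b) w = env_act a (env_act b w)"
  by (induction a rule: uea.abs_induct; induction b rule: uea.abs_induct)
     (simp add: times_uea.abs_eq env_act_abs fa_act_mult)

lemma env_act_of: "env_act (uea_of x) w = lie_act x w"
  by (simp add: uea_of.abs_eq env_act_abs fa_act_gen)

lemma env_act_linear: "clinear (env_act a)"
  unfolding env_act_def[abs_def] by (rule fa_act_linear)

lemma env_act_balancing: "r \<in> balancing_relations \<Longrightarrow> env_act r m0 = 0"
  unfolding balancing_relations_def
proof (induction rule: cvs.span_induct_alt)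
  case base
  then show ?case using env_act_diff[of 0 0 m0] by simp
next
  case (step c r s)
  then obtain a x where "r = a * uea_of x - central_part x *\<^sub>C a" "x \<in> affine_nonneg" by blast
  with step.IH show ?case
    by (simp add: env_act_add env_act_diff env_act_scale env_act_mult env_act_of lie_act_vacuum
        clinear_scale[OF env_act_linear])
qed

definition from_heis :: "'h heis \<Rightarrow> 'm" where
  "from_heis v = env_act (rep_heis v) m0"

lemma from_heis_abs: "from_heis (abs_heis a) = env_act a m0"
proof -
  have "heis_cong (rep_heis (abs_heis a)) a"
    by (rule Quotient3_rep_abs[OF Quotient3_heis])
      (simp add: heis_cong_def balancing_relations_def cvs.span_zero)
  then show ?thesis
    using env_act_balancing[of "rep_heis (abs_heis a) - a"]
    by (simp add: from_heis_def heis_cong_def env_act_diff)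
qed

text \<open>
  The next three lemmas are the universal property: \<open>from_heis\<close> is a homomorphism of Heisenberg
  modules sending the vacuum to \<open>m0\<close>. It is applied to a module of power series, to see that the
  vacuum is nonzero, and to the induced module with its action twisted by an isometry, to lift the
  isometry.
\<close>

lemma from_heis_linear: "clinear from_heis"
proof (rule clinearI)
  fix v w :: "'h heis" and c
  show "from_heis (v + w) = from_heis v + from_heis w"
    by (induction v rule: heis.abs_induct; induction w rule: heis.abs_induct)
       (simp add: plus_heis.abs_eq from_heis_abs env_act_add)
  show "from_heis (c *\<^sub>C v) = c *\<^sub>C from_heis v"
    by (induction v rule: heis.abs_induct)
       (simp add: scaleC_heis.abs_eq from_heis_abs env_act_scale)
qed

lemma from_heis_vacuum: "from_heis vacuum = m0"
  by (simp add: vacuum.abs_eq from_heis_abs one_uea.abs_eq env_act_abs fa_act_single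
      word_act_def zero_word_def scaleC_one flip: single_one)

lemma from_heis_hmode: "from_heis (hmode u n v) = M u n (from_heis v)"
  by (induction v rule: heis.abs_induct)
     (simp add: hmode_def uea_act_abs from_heis_abs env_act_mult env_act_of lie_act_mode)

end

section \<open>A polynomial model and the nonvanishing of the vacuum\<close>

text \<open>
  The operators of the model are multiplication by variables and partial differentiation. Functions
  on exponents, that is formal power series, are used in place of polynomials because all operators
  are then given by pointwise formulas. Variables are indexed by pairs of a basis vector of
  the space and a positive mode number.
\<close>

instantiation complex :: complex_vector
begin
definition scaleC_complex :: "complex \<Rightarrow> complex \<Rightarrow> complex" where
  "scaleC_complex = (*)"
instance by standard (simp_all add: scaleC_complex_def algebra_simps)
end

instantiation "fun" :: (type, complex_vector) complex_vector
begin
definition scaleC_fun :: "complex \<Rightarrow> ('a \<Rightarrow> 'b) \<Rightarrow> 'a \<Rightarrow> 'b" where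
  "scaleC_fun c f = (\<lambda>x. c *\<^sub>C f x)"
instance
  by standard (simp_all add: scaleC_fun_def fun_eq_iff scaleC_add_right scaleC_add_left scaleC_scaleC scaleC_one)
end

type_synonym 'i power_series = "('i \<Rightarrow> nat) \<Rightarrow> complex"

definition ps_times_var :: "'i \<Rightarrow> 'i power_series \<Rightarrow> 'i power_series" where
  "ps_times_var i F = (\<lambda>\<alpha>. if \<alpha> i = 0 then 0 else F (\<alpha>(i := \<alpha> i - 1)))"

definition ps_deriv :: "'i \<Rightarrow> 'i power_series \<Rightarrow> 'i power_series" where
  "ps_deriv i F = (\<lambda>\<alpha>. of_nat (Suc (\<alpha> i)) * F (\<alpha>(i := Suc (\<alpha> i))))"

definition ps_one :: "'i power_series" where
  "ps_one = (\<lambda>\<alpha>. if \<alpha> = (\<lambda>_. 0) then 1 else 0)"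

lemma ps_times_var_linear: "clinear (ps_times_var i)"
  by (rule clinearI) (auto simp: ps_times_var_def scaleC_fun_def scaleC_complex_def)

lemma ps_deriv_linear: "clinear (ps_deriv i)"
  by (rule clinearI) (auto simp: ps_deriv_def scaleC_fun_def scaleC_complex_def algebra_simps)

lemma ps_times_var_commute: "ps_times_var i (ps_times_var j F) = ps_times_var j (ps_times_var i F)"
  by (cases "i = j") (auto simp: ps_times_var_def fun_upd_twist)

lemma ps_deriv_commute: "ps_deriv i (ps_deriv j F) = ps_deriv j (ps_deriv i F)"
  by (cases "i = j") (auto simp: ps_deriv_def fun_upd_twist)

lemma ps_deriv_times_var:
  "ps_deriv i (ps_times_var j F) = ps_times_var j (ps_deriv i F) + (if i = j then F else 0)"
  by (cases "i = j")
    (auto simp: ps_deriv_def ps_times_var_def fun_eq_iff fun_upd_twist fun_upd_idem algebra_simps)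

lemma ps_deriv_one: "ps_deriv i ps_one = 0"
  by (auto simp: ps_deriv_def ps_one_def fun_eq_iff)

definition fock_op :: "'b \<Rightarrow> int \<Rightarrow> ('b \<times> int) power_series \<Rightarrow> ('b \<times> int) power_series" where
  "fock_op b n = (if n < 0 then ps_times_var (b, - n) else ps_deriv (b, n))"

lemma fock_op_linear: "clinear (fock_op b n)"
  by (simp add: fock_op_def ps_times_var_linear ps_deriv_linear)

text \<open>
  The canonical commutation relations. Creation and annihilation at opposite mode numbers fail to
  commute by the sign of the mode number; the number itself is put into the coefficients of the modes.
\<close>

lemma fock_op_commute:
  "fock_op b m (fock_op b' n F) - fock_op b' n (fock_op b m F) =
     (if b = b' \<and> m = - n then of_int (sgn m) else 0) *\<^sub>C F"
proof -
  have neg: "(- 1) *\<^sub>C F = - F" 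
    by (simp add: cvs.scale_minus_left scaleC_one)
  show ?thesis
    by (auto simp: fock_op_def ps_times_var_commute ps_deriv_commute ps_deriv_times_var scaleC_one neg sgn_if
       split: if_splits)
qed

text \<open>
  A basis \<open>B\<close> need not be orthonormal: creation operators use the coordinates of \<open>u\<close> and
  annihilation operators its pairings with the basis vectors, so that the sum over
  \<open>B\<close> of their products is the form. At \<open>n = 0\<close> the coefficients are zero, as the zero mode acts
  by zero on the induced module as well.
\<close>

definition fock_mode :: "'h::formed_space set \<Rightarrow> 'h \<Rightarrow> int \<Rightarrow> ('h \<times> int) power_series \<Rightarrow> ('h \<times> int) power_series" where
  "fock_mode B u n F = (\<Sum>b\<in>B.
     (if n < 0 then cvs.representation B u b else of_int n * form u b) *\<^sub>C fock_op b n F)"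

lemma finite_basis_exists:
  obtains B :: "'h::formed_space set" where "finite B" "cvs.independent B" "cvs.span B = UNIV"
proof -
  obtain C :: "'h set" where C: "finite C" "\<And>x. \<exists>c. x = (\<Sum>b\<in>C. c b *\<^sub>C b)"
    using finite_dimensional by blast
  have "x \<in> cvs.span C" for x
    using C(2)[of x] by (metis (no_types, lifting) cvs.span_base cvs.span_scale cvs.span_sum)
  then have C_span: "cvs.span C = UNIV" by blast
  obtain B where B: "B \<subseteq> C" "cvs.independent B" "C \<subseteq> cvs.span B"
    using cvs.maximal_independent_subset[of C] by blast
  have "cvs.span C \<subseteq> cvs.span B"
    using B(3) by (simp add: cvs.span_minimal)
  with C_span have "cvs.span B = UNIV" by blast
  with that B C(1) finite_subset show ?thesis by blast
qed

lemma form_sum_right: "form x (\<Sum>a\<in>A. f a) = (\<Sum>a\<in>A. form x (f a))"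
  by (induction A rule: infinite_finite_induct) (simp_all add: form_add_right)

text \<open>
  By bilinearity the commutator of two modes is a double sum over the basis. Its diagonal terms, which
  are the only ones that survive, sum up to the expansion of \<open>form u v\<close> in the coordinates of
  the vector that carries the negative mode.
\<close>

lemma fock_module:
  assumes B: "finite B" "cvs.independent B" "cvs.span B = (UNIV :: 'h::formed_space set)"
  shows "heisenberg_module (fock_mode B) ps_one"
proof (rule heisenberg_module.intro)
  have rep_add: "cvs.representation B (u + v) b = cvs.representation B u b + cvs.representation B v b"
    for u v b using B by (simp add: cvs.representation_add)
  have rep_scale: "cvs.representation B (c *\<^sub>C u) b = c * cvs.representation B u b"
    for c u b using B by (simp add: cvs.representation_scale)
  have rep_form: "(\<Sum>b\<in>B. form u b * cvs.representation B v b) = form u v" for u v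
  proof -
    have "form u v = form u (\<Sum>b\<in>B. cvs.representation B v b *\<^sub>C b)"
      using cvs.sum_representation_eq[of B v B] B by simp
    then show ?thesis by (simp add: form_sum_right form_scale_right mult.commute)
  qed
  fix u v :: 'h and m n :: int and c and w :: "('h \<times> int) power_series"
  show "fock_mode B (u + v) n w = fock_mode B u n w + fock_mode B v n w"
    unfolding fock_mode_def sum.distrib[symmetric]
    by (rule sum.cong) (simp_all add: rep_add form_add_left distrib_left scaleC_add_left)
  show "fock_mode B (c *\<^sub>C u) n w = c *\<^sub>C fock_mode B u n w"
    by (auto simp: fock_mode_def rep_scale form_scale_left cvs.scale_sum_right scaleC_scaleC
        algebra_simps intro!: sum.cong)
  show "clinear (fock_mode B u n)"
    by (rule clinearI) (simp_all add: fock_mode_def clinear_add[OF fock_op_linear]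
        clinear_scale[OF fock_op_linear] scaleC_add_right sum.distrib cvs.scale_sum_right
        scaleC_scaleC mult.commute)
  show "fock_mode B u n ps_one = 0" if "0 \<le> n"
    using that by (simp add: fock_mode_def fock_op_def ps_deriv_one)
  define co where "co u n b =
    (if n < 0 then cvs.representation B u b else of_int n * form u b)" for u n b
  have mode: "fock_mode B u n F = (\<Sum>b\<in>B. co u n b *\<^sub>C fock_op b n F)" for u n F
    by (simp add: fock_mode_def co_def)
  have "fock_mode B u m (fock_mode B v n w) - fock_mode B v n (fock_mode B u m w) =
     (\<Sum>b\<in>B. \<Sum>b'\<in>B. (co u m b * co v n b') *\<^sub>C fock_op b m (fock_op b' n w)) -
     (\<Sum>b'\<in>B. \<Sum>b\<in>B. (co u m b * co v n b') *\<^sub>C fock_op b' n (fock_op b m w))"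
    by (simp add: mode clinear_sum[OF fock_op_linear] clinear_scale[OF fock_op_linear]
        cvs.scale_sum_right scaleC_scaleC mult.commute)
  also have "\<dots> = (\<Sum>b\<in>B. \<Sum>b'\<in>B. (co u m b * co v n b') *\<^sub>C
      (fock_op b m (fock_op b' n w) - fock_op b' n (fock_op b m w)))"
    by (subst (2) sum.swap) (simp add: sum_subtractf cvs.scale_right_diff_distrib)
  also have "\<dots> = (\<Sum>b\<in>B. \<Sum>b'\<in>B. if b' = b then
      (if m = - n then of_int (sgn m) * co u m b * co v n b else 0) *\<^sub>C w else 0)"
    by (intro sum.cong refl) (auto simp: fock_op_commute scaleC_scaleC mult_ac)
  also have "\<dots> = (\<Sum>b\<in>B. if m = - n then of_int (sgn m) * co u m b * co v n b else 0) *\<^sub>C w"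
    by (simp add: sum.delta' B(1) cvs.scale_sum_left)
  also have "(\<Sum>b\<in>B. if m = - n then of_int (sgn m) * co u m b * co v n b else 0) =
      (if m = - n then of_int m * form u v else 0)"
  proof -
    have "(\<Sum>b\<in>B. of_int (sgn m) * co u m b * co v (- m) b) = of_int m * form u v"
    proof (cases m "0 :: int" rule: linorder_cases)
      case less
      then have "(\<Sum>b\<in>B. of_int (sgn m) * co u m b * co v (- m) b) =
        of_int m * (\<Sum>b\<in>B. form v b * cvs.representation B u b)"
        by (simp add: co_def sum_distrib_left mult_ac)
      then show ?thesis by (simp add: rep_form form_sym[of v u])
    next
      case equal
      then show ?thesis by simp
    next
      case greater
      then have "(\<Sum>b\<in>B. of_int (sgn m) * co u m b * co v (- m) b) =
        of_int m * (\<Sum>b\<in>B. form u b * cvs.representation B v b)"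
        by (simp add: co_def sum_distrib_left mult_ac)
      then show ?thesis by (simp add: rep_form)
    qed
    then show ?thesis by auto
  qed
  finally show "fock_mode B u m (fock_mode B v n w) - fock_mode B v n (fock_mode B u m w) =
     (if m = - n then of_int m * form u v else 0) *\<^sub>C w" .
qed

text \<open>
  The universal property sends the vacuum to the constant power series \<open>1\<close>.
\<close>

lemma vacuum_nonzero: "(vacuum :: 'h::formed_space heis) \<noteq> 0"
proof
  obtain B :: "'h set" where B: "finite B" "cvs.independent B" "cvs.span B = UNIV"
    by (rule finite_basis_exists)
  interpret heisenberg_module "fock_mode B" ps_one
    by (rule fock_module[OF B])
  assume "(vacuum :: 'h heis) = 0"
  then have "(ps_one :: ('h \<times> int) power_series) = 0"
    using from_heis_vacuum clinear_zero[OF from_heis_linear] by simp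
  from fun_cong[OF this, of "\<lambda>_. 0"]
  show False by (simp add: ps_one_def)
qed

section \<open>The Heisenberg relations and cyclicity of the induced module\<close>

lemma uea_act_mult: "uea_act (a * b) v = uea_act a (uea_act b v)"
  by (induction v rule: heis.abs_induct) (simp add: uea_act_abs mult.assoc)

lemma uea_act_add: "uea_act (a + b) v = uea_act a v + uea_act b v"
  by (induction v rule: heis.abs_induct) (simp add: uea_act_abs distrib_right plus_heis.abs_eq)

lemma uea_act_diff: "uea_act (a - b) v = uea_act a v - uea_act b v"
  using uea_act_add[of "a - b" b v] by simp

lemma uea_act_scale: "uea_act (c *\<^sub>C a) v = c *\<^sub>C uea_act a v"
  by (induction v rule: heis.abs_induct)
     (simp add: uea_act_abs scaleC_uea_mult_left scaleC_heis.abs_eq)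

lemma uea_act_one: "uea_act 1 v = v"
  by (induction v rule: heis.abs_induct) (simp add: uea_act_abs)

lemma uea_act_linear: "clinear (uea_act a)"
proof (rule clinearI)
  fix v w :: "'a heis" and c
  show "uea_act a (v + w) = uea_act a v + uea_act a w"
    by (induction v rule: heis.abs_induct; induction w rule: heis.abs_induct)
       (simp add: plus_heis.abs_eq uea_act_abs distrib_left)
  show "uea_act a (c *\<^sub>C v) = c *\<^sub>C uea_act a v"
    by (induction v rule: heis.abs_induct)
       (simp add: scaleC_heis.abs_eq uea_act_abs scaleC_uea_mult_right)
qed

lemma uea_act_vacuum: "uea_act a vacuum = abs_heis a"
  by (simp add: vacuum.abs_eq uea_act_abs)

lemma uea_of_add: "uea_of (x + y) = uea_of x + uea_of y"
  by transfer (use rel_add in \<open>simp add: uea_cong_def diff_diff_eq\<close>)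

lemma uea_of_scale: "uea_of (c *\<^sub>C x) = c *\<^sub>C uea_of x"
  by transfer (simp add: uea_cong_def rel_scale)

lemma uea_of_linear: "clinear uea_of"
  by (rule clinearI) (simp_all add: uea_of_add uea_of_scale)

lemma uea_of_bracket: "uea_of (bracket x y) = uea_of x * uea_of y - uea_of y * uea_of x"
proof -
  have "uea_of x * uea_of y - uea_of y * uea_of x = uea_of (bracket x y)"
    by transfer (simp add: uea_cong_def rel_bracket)
  then show ?thesis by simp
qed

lemma uea_induct [case_names const of add mult]:
  assumes "\<And>c. P (c *\<^sub>C 1)" "\<And>x. P (uea_of x)"
    "\<And>a b. P a \<Longrightarrow> P b \<Longrightarrow> P (a + b)" "\<And>a b. P a \<Longrightarrow> P b \<Longrightarrow> P (a * b)"
  shows "P a"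
proof (induction a rule: uea.abs_induct)
  case (1 p)
  show ?case
  proof (induction p rule: free_algebra_induct)
    case (single w c)
    have const: "P (abs_uea (Poly_Mapping.single 0 c))" for c
      using assms(1)[of c] by (simp add: one_uea.abs_eq scaleC_uea.abs_eq fa_const_def)
    have "P (abs_uea (Poly_Mapping.single (Word xs) 1))" for xs
    proof (induction xs)
      case Nil
      then show ?case using const[of 1] by (simp add: zero_word_def)
    next
      case (Cons x xs)
      have "Poly_Mapping.single (Word (x # xs)) (1 :: complex) =
          fa_gen x * Poly_Mapping.single (Word xs) 1"
        by (simp add: fa_gen_def mult_single plus_word_def)
      then show ?case
        using assms(4)[OF assms(2) Cons.IH] by (simp add: times_uea.abs_eq uea_of.abs_eq)
    qed
    from assms(4)[OF const[of c] this[of "letters w"]] show ?case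
      by (simp add: times_uea.abs_eq mult_single)
  next
    case (sum p q)
    then show ?case using assms(3)[of "abs_uea p" "abs_uea q"] by (simp add: plus_uea.abs_eq)
  qed
qed

text \<open>
  The central element commutes with the whole enveloping algebra, so it can be moved past any element
  to the vacuum, where the balancing relations evaluate it.
\<close>

lemma central_acts: "uea_act (uea_of (Affine 0 c)) v = c *\<^sub>C v"
proof -
  have comm: "uea_of (Affine 0 c) * a = a * uea_of (Affine 0 c)" for a :: "'a affine uea"
  proof (induction a rule: uea_induct)
    case (of x)
    have "bracket (Affine 0 c) x = 0"
      by (simp add: bracket_affine_def affine_cocycle_def zero_affine_def)
    then show ?case
      using uea_of_bracket[of "Affine 0 c" x] clinear_zero[OF uea_of_linear]
      by (metis eq_iff_diff_eq_0)
  next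
    case (add a b)
    then show ?case by (simp add: algebra_simps)
  next
    case (mult a b)
    then show ?case by (metis mult.assoc)
  qed (simp add: scaleC_uea_mult_left scaleC_uea_mult_right)
  show ?thesis
  proof (induction v rule: heis.abs_induct)
    case (1 a)
    have "a * uea_of (Affine 0 c) - c *\<^sub>C a \<in> balancing_relations"
      unfolding balancing_relations_def
      by (rule cvs.span_base, rule CollectI, intro exI[of _ a] exI[of _ "Affine 0 c"])
        (simp add: affine_nonneg_def)
    then have "abs_heis (a * uea_of (Affine 0 c)) = abs_heis (c *\<^sub>C a)"
      by (simp add: heis.abs_eq_iff heis_cong_def)
    then show ?case by (simp add: uea_act_abs comm scaleC_heis.abs_eq)
  qed
qed

lemma hmode_linear: "clinear (hmode u n)"
  by (simp add: hmode_def uea_act_linear)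

lemma hmode_add: "hmode (u + v) n w = hmode u n w + hmode v n w"
proof -
  have "Affine (Poly_Mapping.single n (u + v)) 0 =
      Affine (Poly_Mapping.single n u) 0 + Affine (Poly_Mapping.single n v) 0"
    by (simp add: plus_affine_def single_add)
  then show ?thesis by (simp add: hmode_def uea_of_add uea_act_add)
qed

lemma hmode_scale: "hmode (c *\<^sub>C u) n w = c *\<^sub>C hmode u n w"
proof -
  have "Affine (Poly_Mapping.single n (c *\<^sub>C u)) 0 = c *\<^sub>C Affine (Poly_Mapping.single n u) 0"
    by (auto simp: scaleC_affine_def lookup_single when_def intro!: poly_mapping_eqI)
  then show ?thesis by (simp add: hmode_def uea_of_scale uea_act_scale)
qed

lemma hmode_commute:
  "hmode u m (hmode v n w) - hmode v n (hmode u m w) =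
     (if m = - n then of_int m * form u v else 0) *\<^sub>C w"
proof -
  have "affine_cocycle (Poly_Mapping.single m u) (Poly_Mapping.single n v) =
      (if m = - n then of_int m * form u v else 0)"
    by (subst affine_cocycle_superset[of "{m}"]) (auto simp: lookup_single when_def)
  then show ?thesis
    by (simp add: hmode_def bracket_affine_def
        flip: uea_act_mult central_acts uea_act_diff uea_of_bracket)
qed

lemma hmode_vacuum:
  assumes "0 \<le> n"
  shows "hmode u n vacuum = 0"
proof -
  let ?x = "Affine (Poly_Mapping.single n u) 0"
  have "?x \<in> affine_nonneg"
    using assms by (auto simp: affine_nonneg_def lookup_single when_def)
  then have "1 * uea_of ?x - central_part ?x *\<^sub>C 1 \<in> balancing_relations"
    unfolding balancing_relations_def by (blast intro: cvs.span_base)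
  then have "abs_heis (uea_of ?x) = abs_heis 0"
    by (simp add: heis.abs_eq_iff heis_cong_def)
  then show ?thesis by (simp add: hmode_def uea_act_vacuum zero_heis.abs_eq)
qed

text \<open>
  The vacuum generates the induced module over the enveloping algebra, which is generated by the
  modes and the central element, and the latter acts by a scalar. This is the induction principle by which every
  later statement about all vectors is reduced to the vacuum and the modes.
\<close>

lemma heis_generated:
  assumes S: "cvs.subspace S" "vacuum \<in> S" "\<And>u n v. v \<in> S \<Longrightarrow> hmode u n v \<in> S"
  shows "v \<in> S"
proof -
  have of: "uea_act (uea_of x) v \<in> S" if "v \<in> S" for x v
  proof -
    define P where "P f \<longleftrightarrow> (\<forall>v\<in>S. uea_act (uea_of (Affine f 0)) v \<in> S)" for f
    have "P f" for f
    proof (induction f rule: Poly_Mapping.update_induct)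
      case const
      then show ?case by (simp add: P_def central_acts cvs.subspace_0[OF S(1)])
    next
      case (update f k u)
      then have "Affine (Poly_Mapping.update k u f) 0 = Affine f 0 + Affine (Poly_Mapping.single k u) 0"
        by (auto simp: plus_affine_def Poly_Mapping.lookup_update lookup_add lookup_single
            when_def in_keys_iff intro!: poly_mapping_eqI)
      with update.IH S(3) show ?case
        by (simp add: P_def uea_of_add uea_act_add cvs.subspace_add[OF S(1)] flip: hmode_def)
    qed
    moreover have "x = Affine (loop_part x) 0 + Affine 0 (central_part x)"
      by (simp add: plus_affine_def)
    ultimately show ?thesis using that
      by (metis (no_types, lifting) P_def uea_of_add uea_act_add central_acts cvs.subspace_add[OF S(1)]
          cvs.subspace_scale[OF S(1)])
  qed
  have act: "\<forall>v\<in>S. uea_act a v \<in> S" for a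
    by (induction a rule: uea_induct)
      (simp_all add: of uea_act_scale uea_act_one uea_act_add uea_act_mult
        cvs.subspace_add[OF S(1)] cvs.subspace_scale[OF S(1)])
  show ?thesis
    using act S(2) by (induction v rule: heis.abs_induct) (simp flip: uea_act_vacuum)
qed

section \<open>Spanning by creation operators and the degree one part\<close>

abbreviation create :: "('h::formed_space \<times> nat) list \<Rightarrow> 'h heis" where
  "create us \<equiv> foldr (\<lambda>(u, m). hmode u (- int m)) us vacuum"

abbreviation creating :: "('h \<times> nat) list \<Rightarrow> bool" where
  "creating us \<equiv> \<forall>(u, m)\<in>set us. 1 \<le> m"

lemma heis_grade_eq:
  "heis_grade n = cvs.span (create ` {us. creating us \<and> sum_list (map snd us) = n})"
  by (simp only: heis_grade_def setcompr_eq_image)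

text \<open>
  The modes with nonnegative index add nothing: commuting such a mode through a product of creation
  operators only removes factors, and it annihilates the vacuum.
\<close>

lemma span_create: "cvs.span (create ` {us :: ('h::formed_space \<times> nat) list. creating us}) = UNIV"
proof -
  let ?S = "cvs.span (create ` {us :: ('h \<times> nat) list. creating us})"
  \<comment> \<open>The second alternative is for \<open>n \<ge> 0\<close>, where it is supplied by the induction that uses the first one.\<close>
  have closed: "hmode u n v \<in> ?S" if v: "v \<in> ?S" and "n < 0 \<or> (\<forall>us. creating us \<longrightarrow> hmode u n (create us) \<in> ?S)"
    for u :: 'h and n v
  proof -
    have *: "hmode u n (create us) \<in> ?S" if "creating us" for us
    proof (cases "n < 0")
      case True
      then have "hmode u n (create us) = create ((u, nat (- n)) # us)" by simp
      moreover have "creating ((u, nat (- n)) # us)" using True that by auto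
      ultimately have "hmode u n (create us) \<in> create ` {us. creating us}"
        by (simp only: image_eqI mem_Collect_eq)
      then show ?thesis by (rule cvs.span_base)
    qed (use that \<open>n < 0 \<or> _\<close> in blast)
    have "?S \<subseteq> {v. hmode u n v \<in> ?S}"
      by (rule cvs.span_minimal) (use * in \<open>auto intro!: clinear_preimage_subspace hmode_linear\<close>)
    with v show ?thesis by blast
  qed
  have annihilate: "hmode u n (create us) \<in> ?S" if "creating us" "0 \<le> n" for u :: 'h and n us
    using that(1)
  proof (induction us)
    case Nil
    then show ?case using that(2) by (simp add: hmode_vacuum cvs.span_zero)
  next
    case (Cons a us)
    obtain v m where a: "a = (v, m)" by force
    have us: "creating us" "1 \<le> m" using Cons.prems a by auto
    have "hmode u n (create (a # us)) = hmode v (- int m) (hmode u n (create us)) +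
        (if n = int m then of_int n * form u v else 0) *\<^sub>C create us"
      using hmode_commute[of u n v "- int m" "create us"] by (simp add: a algebra_simps)
    moreover have "hmode v (- int m) (hmode u n (create us)) \<in> ?S"
      using closed[OF Cons.IH[OF us(1)], of "- int m" v] us(2) by simp
    moreover have "create us \<in> ?S" using us(1) by (auto intro: cvs.span_base)
    ultimately show ?case by (simp add: cvs.span_add cvs.span_scale)
  qed
  have vac: "vacuum \<in> ?S"
  proof (rule cvs.span_base)
    have "create [] \<in> create ` {us :: ('h \<times> nat) list. creating us}" by (rule imageI) simp
    then show "vacuum \<in> create ` {us :: ('h \<times> nat) list. creating us}" by simp
  qed
  have "hmode u n v \<in> ?S" if "v \<in> ?S" for u n v
  proof (rule closed[OF that])
    show "n < 0 \<or> (\<forall>us. creating us \<longrightarrow> hmode u n (create us) \<in> ?S)"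
      using annihilate not_le by blast
  qed
  with vac have "v \<in> ?S" for v
    using heis_generated[OF cvs.subspace_span] by blast
  then show ?thesis by blast
qed

lemma embed_linear: "clinear embed"
  by (rule clinearI) (simp_all add: embed_def hmode_add hmode_scale)

text \<open>
  The pairing of creation and annihilation operators recovers the form from the module. It shows that
  creation operators are injective on the vacuum, and later that an automorphism preserves the form.
\<close>

lemma annihilate_creation:
  assumes "0 < n"
  shows "hmode u n (hmode v (- n) vacuum) = (of_int n * form u v) *\<^sub>C vacuum"
  using hmode_commute[of u n v "- n" vacuum] assms
  by (simp add: hmode_vacuum clinear_zero[OF hmode_linear])

lemma creation_injective:
  assumes "0 < n" "hmode v (- n) vacuum = 0"
  shows "v = 0"
proof (rule form_nondegenerate)
  fix u
  have "(of_int n * form u v) *\<^sub>C (vacuum :: 'a heis) = 0"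
    using annihilate_creation[OF assms(1), of u v] unfolding assms(2) clinear_zero[OF hmode_linear]
    by (rule sym)
  then have "of_int n * form u v = 0" by (simp add: vacuum_nonzero)
  then show "form v u = 0" using assms(1) by (simp add: form_sym)
qed

lemma embed_inj: "inj embed"
proof (rule injI)
  fix u v :: 'a
  assume "embed u = embed v"
  then have "embed (u - v) = 0" by (simp add: clinear_diff[OF embed_linear])
  then show "u = v" using creation_injective[of 1 "u - v"] by (simp add: embed_def)
qed

lemma creation_list_degree_1:
  "creating us \<and> sum_list (map snd us) = 1 \<longleftrightarrow> (\<exists>u. us = [(u, 1 :: nat)])"
proof (cases us)
  case (Cons a vs)
  show ?thesis
  proof
    assume *: "creating us \<and> sum_list (map snd us) = 1"
    then have "1 \<le> snd a" "snd a + sum_list (map snd vs) = 1" using Cons by auto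
    then have a: "snd a = 1" and vs: "sum_list (map snd vs) = 0" by linarith+
    have "vs = []"
    proof (rule ccontr)
      assume "vs \<noteq> []"
      then obtain b where "b \<in> set vs" by (cases vs) auto
      with * Cons vs show False by (cases b) fastforce
    qed
    with a Cons show "\<exists>u. us = [(u, 1)]" by (cases a) auto
  qed auto
qed simp

lemma heis_grade_1: "heis_grade 1 = range (embed :: 'h::formed_space \<Rightarrow> 'h heis)"
proof -
  have "create ` {us. creating us \<and> sum_list (map snd us) = 1} = range (embed :: 'h \<Rightarrow> 'h heis)"
    unfolding creation_list_degree_1 embed_def by (auto simp: image_iff) force
  moreover have "cvs.span (range (embed :: 'h \<Rightarrow> 'h heis)) = range embed"
    using clinear_image_span[OF embed_linear, of UNIV] unfolding cvs.span_UNIV by (rule sym)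
  ultimately show ?thesis by (simp only: heis_grade_eq)
qed

section \<open>Lifting isometries\<close>

definition orthogonal :: "('h::formed_space \<Rightarrow> 'h) \<Rightarrow> bool" where
  "orthogonal g \<longleftrightarrow> clinear g \<and> bij g \<and> (\<forall>u v. form (g u) (g v) = form u v)"

lemma orthogonal_inverse:
  assumes "orthogonal g"
  shows "orthogonal (inv_into UNIV g)"
proof -
  let ?k = "inv_into UNIV g"
  have g: "clinear g" "bij g" "\<And>u v. form (g u) (g v) = form u v"
    using assms by (auto simp: orthogonal_def)
  have gk: "g (?k x) = x" for x
    using g(2) by (simp add: bij_is_surj surj_f_inv_f)
  have "clinear ?k" by (rule clinear_inverse[OF g(1,2)])
  moreover have "form (?k u) (?k v) = form u v" for u v
    using g(3)[of "?k u" "?k v"] by (simp add: gk)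
  ultimately show ?thesis using g(2) by (simp add: orthogonal_def bij_imp_bij_inv)
qed

text \<open>
  If \<open>g\<close> is an isometry, the twisted modes \<open>(g u)(n)\<close> satisfy the same commutation
  relations as the modes \<open>u(n)\<close>, so the universal property applies to them.
\<close>

definition fock_lift :: "('h::formed_space \<Rightarrow> 'h) \<Rightarrow> 'h heis \<Rightarrow> 'h heis" where
  "fock_lift g = heisenberg_module.from_heis (\<lambda>u. hmode (g u)) vacuum"

text \<open>
  For a map \<open>g\<close> that is not an isometry, the module axioms fail and \<open>fock_lift g\<close> has no meaning.
\<close>

lemma
  assumes "orthogonal g"
  shows fock_lift_linear: "clinear (fock_lift g)"
    and fock_lift_vacuum: "fock_lift g vacuum = vacuum"
    and fock_lift_hmode: "fock_lift g (hmode u n v) = hmode (g u) n (fock_lift g v)"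
proof -
  have g: "clinear g" "\<And>u v. form (g u) (g v) = form u v"
    using assms by (auto simp: orthogonal_def)
  interpret heisenberg_module "\<lambda>u. hmode (g u)" vacuum
    by (rule heisenberg_module.intro) (simp_all add: clinear_add[OF g(1)] clinear_scale[OF g(1)] hmode_add hmode_scale
        hmode_linear hmode_vacuum hmode_commute g(2))
  show "clinear (fock_lift g)" "fock_lift g vacuum = vacuum"
    "fock_lift g (hmode u n v) = hmode (g u) n (fock_lift g v)"
    unfolding fock_lift_def by (rule from_heis_linear from_heis_vacuum from_heis_hmode)+
qed

lemma fock_lift_embed: "orthogonal g \<Longrightarrow> fock_lift g (embed u) = embed (g u)"
  by (simp add: embed_def fock_lift_hmode fock_lift_vacuum)

lemma intertwiner_unique:
  assumes f: "clinear f" "f vacuum = vacuum" "\<And>u n v. f (hmode u n v) = hmode (g u) n (f v)"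
    and h: "clinear h" "h vacuum = vacuum" "\<And>u n v. h (hmode u n v) = hmode (g u) n (h v)"
  shows "f v = h v"
proof -
  have "v \<in> {v. f v = h v}"
    by (rule heis_generated) (auto simp: cvs.subspace_def clinear_zero[OF f(1)] clinear_zero[OF h(1)]
      clinear_add[OF f(1)] clinear_add[OF h(1)] clinear_scale[OF f(1)] clinear_scale[OF h(1)] f(2,3) h(2,3))
  then show ?thesis by blast
qed

lemma fock_lift_inverse:
  assumes "orthogonal g" "orthogonal k" "\<And>u. g (k u) = u"
  shows "fock_lift g (fock_lift k v) = v"
  by (rule intertwiner_unique[where g = "\<lambda>u. u" and f = "\<lambda>v. fock_lift g (fock_lift k v)"
        and h = "\<lambda>v. v" and v = v])
     (simp_all add: fock_lift_vacuum fock_lift_hmode assms clinear_compose fock_lift_linear clinearI)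

lemma fock_lift_bij:
  assumes g: "orthogonal g"
  shows "bij (fock_lift g)"
proof (rule bij_betw_byWitness[where f' = "fock_lift (inv_into UNIV g)"])
  have bij: "bij g" using g by (simp add: orthogonal_def)
  show "\<forall>v\<in>UNIV. fock_lift (inv_into UNIV g) (fock_lift g v) = v"
    by (intro ballI fock_lift_inverse[OF orthogonal_inverse[OF g] g] inv_f_f bij_is_inj[OF bij])
  show "\<forall>v\<in>UNIV. fock_lift g (fock_lift (inv_into UNIV g) v) = v"
    using fock_lift_inverse[OF g orthogonal_inverse[OF g] surj_f_inv_f[OF bij_is_surj[OF bij]]] by blast
qed simp_all

lemma fock_lift_grade:
  assumes "orthogonal g"
  shows "fock_lift g ` heis_grade n = heis_grade n"
proof -
  have sub: "fock_lift g ` heis_grade n \<subseteq> heis_grade n" if g: "orthogonal g" for g :: "'a \<Rightarrow> 'a"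
  proof -
    have create: "fock_lift g (create us) = create (map (\<lambda>(u, m). (g u, m)) us)" for us
      by (induction us) (auto simp: fock_lift_vacuum[OF g] fock_lift_hmode[OF g])
    have degree: "sum_list (map snd (map (\<lambda>(u, m). (g u, m)) us)) = sum_list (map snd us)"
      for us :: "('a \<times> nat) list" by (induction us) auto
    have "fock_lift g (create us) \<in> create ` {us. creating us \<and> sum_list (map snd us) = n}"
      if "creating us" "sum_list (map snd us) = n" for us
      unfolding create
      by (rule imageI) (use that in \<open>auto simp: degree simp del: map_map\<close>)
    then have "fock_lift g ` create ` {us. creating us \<and> sum_list (map snd us) = n}
        \<subseteq> create ` {us. creating us \<and> sum_list (map snd us) = n}"
      by blast
    then show ?thesis
      by (simp add: heis_grade_eq clinear_image_span[OF fock_lift_linear[OF g]] cvs.span_mono)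
  qed
  let ?k = "inv_into UNIV g"
  have bij: "bij g" using assms by (simp add: orthogonal_def)
  have "fock_lift g (fock_lift ?k v) = v" for v
    by (rule fock_lift_inverse[OF assms orthogonal_inverse[OF assms] surj_f_inv_f[OF bij_is_surj[OF bij]]])
  then have "heis_grade n \<subseteq> fock_lift g ` heis_grade n"
    using sub[OF orthogonal_inverse[OF assms]] by (metis image_iff image_subset_iff subsetI)
  then show ?thesis using sub[OF assms] by blast
qed

section \<open>Consequences of the Borcherds identity\<close>

text \<open>
  An injective map preserves the support of a family. So either both supports are finite, or both
  are infinite and both sides are zero by convention.
\<close>

lemma Sum_any_inj:
  assumes "clinear f" "inj f"
  shows "f (Sum_any F) = Sum_any (\<lambda>i. f (F i))"
proof -
  have "f x = 0 \<longleftrightarrow> x = 0" for x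
    using assms clinear_zero[OF assms(1)] by (metis injD)
  then show ?thesis
    by (simp add: Sum_any.expand_set clinear_sum[OF assms(1)] clinear_zero[OF assms(1)])
qed

lemma Sum_any_at_0:
  assumes "\<And>i. 0 < i \<Longrightarrow> F i = 0"
  shows "Sum_any F = F (0 :: nat)"
proof -
  have "{i. F i \<noteq> 0} \<subseteq> {0}" using assms by auto
  then show ?thesis by (simp add: Sum_any.expand_superset[of "{0}"])
qed

context vertex_algebra
begin

text \<open>
  The cases \<open>m = 0\<close> and \<open>n = 0\<close> of the Borcherds identity, in each of which one of the two sums
  collapses to its term at \<open>i = 0\<close>. The first expresses the modes of \<open>Y u n v\<close> through those of
  \<open>u\<close> and \<open>v\<close>; the second is the commutator formula.
\<close>

lemma associator:
  "Y (Y u n v) k w = Sum_any (\<lambda>i::nat. ((- 1) ^ i * (of_int n gchoose i)) *\<^sub>C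
     (Y u (n - int i) (Y v (k + int i) w) - ((- 1) powi n) *\<^sub>C Y v (n + k - int i) (Y u (int i) w)))"
  using borcherds[where m = 0 and n = n and k = k and u = u and v = v and w = w]
  by (subst (asm) Sum_any_at_0) (simp_all add: gbinomial_0_left scaleC_one)

lemma commutator:
  "Y u m (Y v k w) - Y v k (Y u m w) =
     Sum_any (\<lambda>i::nat. (of_int m gchoose i) *\<^sub>C Y (Y u (int i) v) (m + k - int i) w)"
  using borcherds[where m = m and n = 0 and k = k and u = u and v = v and w = w]
  by (subst (asm) (2) Sum_any_at_0) (simp_all add: gbinomial_0_left scaleC_one)

text \<open>
  Hence it suffices to verify the compatibility of a linear bijection with all products on
  generators in the first argument.
\<close>

lemma automorphism_generators:
  assumes \<sigma>: "clinear \<sigma>" "inj \<sigma>"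
    and u: "\<And>n w. \<sigma> (Y u n w) = Y (\<sigma> u) n (\<sigma> w)"
    and v: "\<And>n w. \<sigma> (Y v n w) = Y (\<sigma> v) n (\<sigma> w)"
  shows "\<sigma> (Y (Y u n v) k w) = Y (\<sigma> (Y u n v)) k (\<sigma> w)"
  by (simp add: associator u v Sum_any_inj[OF \<sigma>] clinear_scale[OF \<sigma>(1)] clinear_diff[OF \<sigma>(1)])

end

section \<open>The conformal vectors\<close>

lemma orthonormal_basis_form:
  assumes "orthonormal_basis bs" "a \<in> set bs" "b \<in> set bs"
  shows "form a b = (if a = b then 1 else 0)"
  using assms unfolding orthonormal_basis_def by (metis in_set_conv_nth)

lemma orthonormal_expansion:
  assumes "orthonormal_basis bs"
  shows "(\<Sum>b\<in>set bs. form x b *\<^sub>C b) = x"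
proof -
  have "x \<in> cvs.span (set bs)" using assms by (simp add: orthonormal_basis_def)
  then obtain c where c: "x = (\<Sum>b\<in>set bs. c b *\<^sub>C b)"
    by (auto simp: cvs.span_finite)
  have "form x b = c b" if "b \<in> set bs" for b
  proof -
    have "form x b = (\<Sum>a\<in>set bs. c a * form a b)"
      by (simp add: c form_sym[of _ b] form_sum_right form_scale_right)
    also have "\<dots> = (\<Sum>a\<in>set bs. if a = b then c a else 0)"
      by (rule sum.cong) (simp_all add: orthonormal_basis_form[OF assms _ that])
    finally show ?thesis using that by simp
  qed
  then show ?thesis using c by simp
qed

lemma omega_eq:
  assumes "orthonormal_basis bs"
  shows "omega bs h = (1 / 2) *\<^sub>C (\<Sum>b\<in>set bs. hmode b (- 1) (embed b)) + hmode h (- 2) vacuum"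
  using assms
  by (simp add: omega_def embed_def orthonormal_basis_def sum_list_distinct_conv_sum_set)

lemma hmode_sum: "hmode (\<Sum>a\<in>A. f a) n w = (\<Sum>a\<in>A. hmode (f a) n w)"
  by (rule clinear_sum) (rule clinearI, simp_all add: hmode_add hmode_scale)

text \<open>
  The tensor \<open>\<Sum> b \<otimes> b\<close> over an orthonormal basis does not depend on the basis. To see this,
  one factor \<open>g b\<close> is expanded in the basis \<open>set bs\<close>, the sums are exchanged, and the remaining
  inner sum is the expansion of a basis vector in the orthonormal basis formed by the \<open>g b\<close>.
\<close>

lemma orthonormal_square_sum_invariant:
  assumes bs: "orthonormal_basis bs" and g: "orthogonal g"
  shows "(\<Sum>b\<in>set bs. hmode (g b) (- 1) (embed (g b))) = (\<Sum>b\<in>set bs. hmode b (- 1) (embed b))"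
proof -
  have lin: "clinear g" and bij: "bij g" and form: "\<And>u v. form (g u) (g v) = form u v"
    using g by (auto simp: orthogonal_def)
  have image_expansion: "(\<Sum>b\<in>set bs. form (g b) c *\<^sub>C g b) = c" for c
  proof -
    obtain d where d: "c = g d" using bij by (metis bij_pointE)
    have "(\<Sum>b\<in>set bs. form (g b) c *\<^sub>C g b) = g (\<Sum>b\<in>set bs. form d b *\<^sub>C b)"
      by (simp add: d form form_sym[of d] clinear_sum[OF lin] clinear_scale[OF lin])
    then show ?thesis by (simp add: orthonormal_expansion[OF bs] d)
  qed
  have "(\<Sum>b\<in>set bs. hmode (g b) (- 1) (embed (g b))) =
      (\<Sum>b\<in>set bs. hmode (\<Sum>c\<in>set bs. form (g b) c *\<^sub>C c) (- 1) (embed (g b)))"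
    by (simp add: orthonormal_expansion[OF bs])
  also have "\<dots> = (\<Sum>c\<in>set bs. \<Sum>b\<in>set bs. form (g b) c *\<^sub>C hmode c (- 1) (embed (g b)))"
    by (simp add: hmode_sum hmode_scale) (rule sum.swap)
  also have "\<dots> = (\<Sum>c\<in>set bs. hmode c (- 1) (embed (\<Sum>b\<in>set bs. form (g b) c *\<^sub>C g b)))"
    by (simp add: clinear_sum[OF embed_linear] clinear_scale[OF embed_linear]
        clinear_sum[OF hmode_linear] clinear_scale[OF hmode_linear])
  finally show ?thesis by (simp add: image_expansion)
qed

text \<open>
  These values at \<open>n \<ge> 0\<close> are the operator product of a generator with the conformal vector,
  and they determine all commutators between their modes.
\<close>

lemma hmode_omega:
  assumes bs: "orthonormal_basis bs" and "0 \<le> n"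
  shows "hmode x n (omega bs h) =
    (if n = 1 then embed x else if n = 2 then (2 * form x h) *\<^sub>C vacuum else 0)"
proof -
  have swap: "hmode x n (hmode v k w) = hmode v k (hmode x n w) +
      (if n = - k then of_int n * form x v else 0) *\<^sub>C w" for v k w
    using hmode_commute[of x n v k w] by (simp add: algebra_simps)
  have quadratic: "hmode x n (hmode b (- 1) (embed b)) = (if n = 1 then (2 * form x b) *\<^sub>C embed b else 0)" for b
  proof -
    have "hmode x n (hmode b (- 1) (embed b)) = (if n = 1 then form x b else 0) *\<^sub>C embed b
        + (if n = 1 then form x b else 0) *\<^sub>C embed b"
      using assms(2)
      by (simp add: swap embed_def hmode_vacuum clinear_zero[OF hmode_linear]
          clinear_scale[OF hmode_linear])
    then show ?thesis by (simp flip: scaleC_add_left)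
  qed
  have linear: "hmode x n (hmode h (- 2) vacuum) = (if n = 2 then (2 * form x h) *\<^sub>C vacuum else 0)"
    using assms(2) by (simp add: swap hmode_vacuum clinear_zero[OF hmode_linear])
  have "(\<Sum>b\<in>set bs. (2 * form x b) *\<^sub>C embed b) = 2 *\<^sub>C embed (\<Sum>b\<in>set bs. form x b *\<^sub>C b)"
    by (simp add: clinear_sum[OF embed_linear] clinear_scale[OF embed_linear] cvs.scale_sum_right
        scaleC_scaleC)
  then show ?thesis
    by (simp add: omega_eq[OF bs] clinear_add[OF hmode_linear] clinear_scale[OF hmode_linear]
        clinear_sum[OF hmode_linear] quadratic linear orthonormal_expansion[OF bs] scaleC_scaleC scaleC_one)
qed

text \<open>
  The quadratic part of the conformal vector is invariant under isometries, so the lift of \<open>g\<close> moves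
  the vector by \<open>(g h - h)(- 2)\<close> applied to the vacuum, which vanishes only if \<open>g h - h\<close> does.
\<close>

lemma fock_lift_omega:
  assumes bs: "orthonormal_basis bs" and g: "orthogonal g"
  shows "fock_lift g (omega bs h) = omega bs h \<longleftrightarrow> g h = h"
proof -
  have lin: "clinear g" using g by (simp add: orthogonal_def)
  have "fock_lift g (omega bs h) = omega bs h + hmode (g h - h) (- 2) vacuum"
    using hmode_add[of "g h - h" h "- 2" vacuum]
    by (simp add: omega_eq[OF bs] clinear_add[OF fock_lift_linear[OF g]]
        clinear_scale[OF fock_lift_linear[OF g]] clinear_sum[OF fock_lift_linear[OF g]]
        fock_lift_hmode[OF g] fock_lift_embed[OF g] fock_lift_vacuum[OF g] orthonormal_square_sum_invariant[OF bs g])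
  then have "fock_lift g (omega bs h) = omega bs h \<longleftrightarrow> hmode (g h - h) (- 2) vacuum = 0" by simp
  also have "\<dots> \<longleftrightarrow> g h - h = 0"
    using creation_injective[of 2 "g h - h"] hmode_scale[of 0 0 "- 2" vacuum] by auto
  finally show ?thesis by simp
qed

section \<open>Groups of maps\<close>

lemma map_group_simps [simp]:
  "carrier (map_group S) = S" "f \<otimes>\<^bsub>map_group S\<^esub> g = f \<circ> g" "\<one>\<^bsub>map_group S\<^esub> = id"
  by (simp_all add: map_group_def)

lemma group_map_group:
  assumes "id \<in> S" "\<And>f g. f \<in> S \<Longrightarrow> g \<in> S \<Longrightarrow> f \<circ> g \<in> S"
    "\<And>f. f \<in> S \<Longrightarrow> \<exists>g\<in>S. g \<circ> f = id"
  shows "group (map_group S)"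
  by (rule groupI) (use assms in \<open>auto simp: o_assoc\<close>)

text \<open>
  This passes from graded automorphisms and isometries to those that fix the conformal vector and
  \<open>h\<close>, respectively.
\<close>

lemma iso_map_group_restrict:
  assumes F: "F \<in> iso (map_group S) (map_group T)" and S': "S' \<subseteq> S"
    and T': "T' \<subseteq> T" "\<And>s. s \<in> S \<Longrightarrow> s \<in> S' \<longleftrightarrow> F s \<in> T'"
  shows "F \<in> iso (map_group S') (map_group T')"
proof -
  have bij: "bij_betw F S T" and hom: "\<And>x y. x \<in> S \<Longrightarrow> y \<in> S \<Longrightarrow> F (x \<circ> y) = F x \<circ> F y"
    using F by (auto simp: iso_def hom_def)
  have "F ` S' = T'"
    using bij_betw_imp_surj_on[OF bij] S' T' by blast
  then have "bij_betw F S' T'"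
    using bij_betw_subset[OF bij S'] by simp
  then show ?thesis
    using hom S' by (auto simp: iso_def hom_def bij_betw_def)
qed

lemma orthogonal_group_eq: "orthogonal_group = map_group {g. orthogonal g}"
  by (simp add: orthogonal_group_def orthogonal_def)

lemma group_orthogonal: "group orthogonal_group"
  unfolding orthogonal_group_eq
proof (rule group_map_group)
  show "id \<in> {g :: 'a \<Rightarrow> 'a. orthogonal g}"
    by (simp add: orthogonal_def clinearI)
  show "f \<circ> g \<in> {g. orthogonal g}" if "f \<in> {g. orthogonal g}" "g \<in> {g. orthogonal g}"
    for f g :: "'a \<Rightarrow> 'a"
    using that by (auto simp: orthogonal_def bij_comp o_def intro: clinear_compose bij_comp[unfolded o_def])
  show "\<exists>g\<in>{g. orthogonal g}. g \<circ> f = id" if "f \<in> {g. orthogonal g}" for f :: "'a \<Rightarrow> 'a"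
    using that orthogonal_inverse[of f]
    by (auto simp: orthogonal_def bij_is_inj intro!: bexI[of _ "inv_into UNIV f"])
qed

lemma va_automorphism_id: "va_automorphism vac Y id"
  by (simp add: va_automorphism_def clinearI)

lemma va_automorphism_comp:
  "va_automorphism vac Y \<sigma> \<Longrightarrow> va_automorphism vac Y \<tau> \<Longrightarrow> va_automorphism vac Y (\<sigma> \<circ> \<tau>)"
  by (auto simp: va_automorphism_def bij_comp intro: clinear_compose[of \<sigma> \<tau>, folded o_def])

lemma va_automorphism_inverse:
  assumes "va_automorphism vac Y \<sigma>"
  shows "va_automorphism vac Y (inv_into UNIV \<sigma>)"
proof -
  let ?\<tau> = "inv_into UNIV \<sigma>"
  have \<sigma>: "clinear \<sigma>" "bij \<sigma>" "\<sigma> vac = vac" "\<And>u n v. \<sigma> (Y u n v) = Y (\<sigma> u) n (\<sigma> v)"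
    using assms by (auto simp: va_automorphism_def)
  have st: "\<sigma> (?\<tau> x) = x" and ts: "?\<tau> (\<sigma> x) = x" for x
    using \<sigma>(2) by (simp_all add: bij_is_surj surj_f_inv_f bij_is_inj)
  have "clinear ?\<tau>" by (rule clinear_inverse[OF \<sigma>(1,2)])
  moreover have "?\<tau> (Y u n v) = Y (?\<tau> u) n (?\<tau> v)" for u n v
    using ts[of "Y (?\<tau> u) n (?\<tau> v)"] by (simp add: \<sigma>(4) st)
  moreover have "?\<tau> vac = vac" using ts[of vac] by (simp add: \<sigma>(3))
  ultimately show ?thesis by (simp add: va_automorphism_def bij_imp_bij_inv[OF \<sigma>(2)])
qed

lemma group_va_automorphisms:
  assumes "P id" "\<And>\<sigma> \<tau>. P \<sigma> \<Longrightarrow> P \<tau> \<Longrightarrow> P (\<sigma> \<circ> \<tau>)"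
    "\<And>\<sigma>. P \<sigma> \<Longrightarrow> bij \<sigma> \<Longrightarrow> P (inv_into UNIV \<sigma>)"
  shows "group (map_group {\<sigma>. va_automorphism vac Y \<sigma> \<and> P \<sigma>})"
proof (rule group_map_group)
  fix \<sigma> assume "\<sigma> \<in> {\<sigma>. va_automorphism vac Y \<sigma> \<and> P \<sigma>}"
  then have \<sigma>: "va_automorphism vac Y \<sigma>" "P \<sigma>" by auto
  then have bij: "bij \<sigma>" by (simp add: va_automorphism_def)
  with \<sigma> assms(3) show "\<exists>\<tau>\<in>{\<sigma>. va_automorphism vac Y \<sigma> \<and> P \<sigma>}. \<tau> \<circ> \<sigma> = id"
    by (intro bexI[of _ "inv_into UNIV \<sigma>"]) (auto simp: va_automorphism_inverse bij_is_inj)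
qed (simp_all add: assms va_automorphism_id va_automorphism_comp)

lemma group_graded_va_aut: "group (graded_va_aut vac Y G)"
  unfolding graded_va_aut_def
proof (rule group_va_automorphisms)
  show "\<forall>n. inv_into UNIV \<sigma> ` G n = G n" if "\<forall>n. \<sigma> ` G n = G n" "bij \<sigma>" for \<sigma>
    using that by (metis bij_is_inj image_inv_f_f)
  show "\<forall>n. (\<sigma> \<circ> \<tau>) ` G n = G n" if "\<forall>n. \<sigma> ` G n = G n" "\<forall>n. \<tau> ` G n = G n" for \<sigma> \<tau>
    using that unfolding image_comp[symmetric] by simp
qed simp

lemma group_voa_aut: "group (voa_aut vac Y \<omega>)"
  unfolding voa_aut_def
proof (rule group_va_automorphisms)
  show "inv_into UNIV \<sigma> \<omega> = \<omega>" if "\<sigma> \<omega> = \<omega>" "bij \<sigma>" for \<sigma>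
    using that by (metis bij_inv_eq_iff)
qed simp_all

section \<open>Eigenspaces and the standard gradation\<close>

text \<open>
  Applying \<open>L - j\<close> to the relation removes the term at \<open>j\<close> and multiplies each other term by the
  nonzero number \<open>i - j\<close>.
\<close>

lemma eigenvectors_independent:
  fixes f :: "nat \<Rightarrow> 'v::complex_vector"
  assumes L: "clinear L" "\<And>i. L (f i) = of_nat i *\<^sub>C f i"
    and "finite A" "(\<Sum>i\<in>A. f i) = 0" "i \<in> A"
  shows "f i = 0"
  using assms(3,4,2,5)
proof (induction A arbitrary: f i rule: finite_induct)
  case (insert j A)
  have "(\<Sum>i\<in>A. (of_nat i - of_nat j) *\<^sub>C f i) =
      L (\<Sum>i\<in>insert j A. f i) - of_nat j *\<^sub>C (\<Sum>i\<in>insert j A. f i)"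
    using insert.hyps
    by (simp add: clinear_sum[OF L(1)] clinear_add[OF L(1)] insert.prems(2) cvs.scale_sum_right
        cvs.scale_left_diff_distrib sum_subtractf scaleC_add_right)
  also have "\<dots> = 0" by (simp only: insert.prems(1) clinear_zero[OF L(1)] cvs.scale_zero_right diff_self)
  finally have "(\<Sum>i\<in>A. (of_nat i - of_nat j) *\<^sub>C f i) = 0" .
  from insert.IH[OF this]
  have "(of_nat i - of_nat j :: complex) *\<^sub>C f i = 0" if "i \<in> A" for i
    using that by (simp add: clinear_scale[OF L(1)] insert.prems(2) scaleC_scaleC mult.commute)
  then have A: "f i = 0" if "i \<in> A" for i
    using that insert.hyps by (metis cvs.scale_eq_0_iff of_nat_eq_iff right_minus_eq)
  then have "f j = 0" using insert.prems(1) insert.hyps by simp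
  with A insert.prems(3) show ?case by auto
qed simp

lemma graded_decomposition:
  "\<exists>A f. finite A \<and> (\<forall>i. f i \<in> heis_grade i) \<and> v = (\<Sum>i\<in>A. f i)"
proof -
  have "v \<in> cvs.span (create ` {us :: ('a \<times> nat) list. creating us})"
    unfolding span_create by (rule UNIV_I)
  then show ?thesis
  proof (induction v rule: cvs.span_induct_alt)
    case base
    show ?case
      by (rule exI[of _ "{}"]) (auto simp: heis_grade_def intro: exI[of _ "\<lambda>_. 0"] cvs.span_zero)
  next
    case (step c w v)
    then obtain us A f where us: "w = create us" "creating us"
      and f: "finite A" "\<And>i. f i \<in> heis_grade i" "v = (\<Sum>i\<in>A. f i)" by blast
    let ?n = "sum_list (map snd us)"
    have w: "w \<in> heis_grade ?n"
      unfolding heis_grade_eq us(1) by (intro cvs.span_base imageI) (use us(2) in simp)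
    define f' where "f' i = (if i \<in> A then f i else 0) + (if i = ?n then c *\<^sub>C w else 0)" for i
    have "f' i \<in> heis_grade i" for i
      using f(2) w by (simp add: f'_def heis_grade_eq cvs.span_add cvs.span_scale cvs.span_zero)
    moreover have "c *\<^sub>C w + v = (\<Sum>i\<in>insert ?n A. f' i)"
    proof -
      have "(\<Sum>i\<in>insert ?n A. if i \<in> A then f i else 0) = (\<Sum>i\<in>A. f i)"
        by (rule sum.mono_neutral_cong_right) (use f(1) in auto)
      then show ?thesis using f(1,3) by (simp add: f'_def sum.distrib del: sum.insert)
    qed
    ultimately show ?case using f(1) by (metis finite_insert)
  qed
qed

section \<open>The automorphism groups\<close>

locale heisenberg_vertex_algebra = vertex_algebra vacuum Y
  for Y :: "'h::formed_space heis \<Rightarrow> int \<Rightarrow> 'h heis \<Rightarrow> 'h heis" +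
  assumes Y_embed: "Y (embed u) n = hmode u n"
begin

text \<open>
  The vectors \<open>u\<close> for which the lift is compatible with all modes of \<open>u\<close> form a subspace. It contains
  the vacuum, contains the degree one vectors by construction of the lift, and is closed under their
  modes by the associator formula, so it is everything.
\<close>

lemma fock_lift_automorphism:
  assumes g: "orthogonal g"
  shows "va_automorphism vacuum Y (fock_lift g)"
proof -
  let ?\<sigma> = "fock_lift g"
  have lin: "clinear ?\<sigma>" by (rule fock_lift_linear[OF g])
  have inj: "inj ?\<sigma>" using fock_lift_bij[OF g] by (rule bij_is_inj)
  define S where "S = {u. \<forall>n w. ?\<sigma> (Y u n w) = Y (?\<sigma> u) n (?\<sigma> w)}"
  have embed: "?\<sigma> (Y (embed x) n w) = Y (?\<sigma> (embed x)) n (?\<sigma> w)" for x n w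
    by (simp add: fock_lift_embed[OF g] Y_embed fock_lift_hmode[OF g])
  have "u \<in> S" for u
  proof (rule heis_generated)
    show "cvs.subspace S"
      unfolding cvs.subspace_def S_def
      using clinear_zero[OF Y_linear_left]
      by (auto simp: clinear_zero[OF lin] clinear_add[OF lin] clinear_scale[OF lin]
          clinear_zero[OF Y_linear_left] clinear_add[OF Y_linear_left] clinear_scale[OF Y_linear_left])
    show "vacuum \<in> S"
      by (simp add: S_def vacuum_left fock_lift_vacuum[OF g] clinear_zero[OF lin])
    show "hmode x n v \<in> S" if "v \<in> S" for x n v
    proof -
      have "?\<sigma> (Y (Y (embed x) n v) k w) = Y (?\<sigma> (Y (embed x) n v)) k (?\<sigma> w)" for k w
        by (rule automorphism_generators[OF lin inj embed]) (use that in \<open>simp add: S_def\<close>)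
      then show ?thesis by (simp add: S_def Y_embed)
    qed
  qed
  then show ?thesis
    by (simp add: va_automorphism_def lin fock_lift_bij[OF g] fock_lift_vacuum[OF g] S_def)
qed

text \<open>
  An automorphism preserving the degree one part permutes the vectors \<open>embed u\<close>, hence intertwines
  the modes of \<open>u\<close> with those of its restriction applied to \<open>u\<close>. The form is
  preserved because \<open>u(1) v(- 1)\<close> applied to the vacuum is \<open>form u v\<close> times the vacuum, and the
  automorphism is the lift of its restriction because the module is cyclic.
\<close>

lemma
  assumes \<sigma>: "va_automorphism vacuum Y \<sigma>" and grade: "\<sigma> ` heis_grade 1 = heis_grade 1"
  shows embed_restrict: "embed (restrict_to_h \<sigma> u) = \<sigma> (embed u)"
    and restrict_orthogonal: "orthogonal (restrict_to_h \<sigma>)"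
    and automorphism_eq_fock_lift: "\<sigma> = fock_lift (restrict_to_h \<sigma>)"
proof -
  let ?g = "restrict_to_h \<sigma>"
  have lin: "clinear \<sigma>" and bij: "bij \<sigma>" and vac: "\<sigma> vacuum = vacuum"
    and Y: "\<And>u n v. \<sigma> (Y u n v) = Y (\<sigma> u) n (\<sigma> v)"
    using \<sigma> by (auto simp: va_automorphism_def)
  have range: "\<sigma> ` range embed = range (embed :: 'h \<Rightarrow> _)"
    using grade by (simp only: heis_grade_1)
  show g: "embed (?g u) = \<sigma> (embed u)" for u
  proof -
    have "\<sigma> (embed u) \<in> range embed" using range by blast
    then show ?thesis by (simp add: restrict_to_h_def f_inv_into_f)
  qed
  have hmode: "\<sigma> (hmode u n v) = hmode (?g u) n (\<sigma> v)" for u n v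
    using Y[of "embed u" n v] by (simp add: Y_embed flip: g)
  have "clinear ?g"
    by (rule clinearI; rule injD[OF embed_inj])
      (simp_all add: g clinear_add[OF lin] clinear_scale[OF lin] clinear_add[OF embed_linear]
        clinear_scale[OF embed_linear])
  moreover have "bij ?g"
  proof (rule bijI)
    show "inj ?g"
      by (rule injI) (metis g bij bij_is_inj embed_inj injD)
    have "\<exists>u. v = ?g u" for v
    proof -
      have "embed v \<in> \<sigma> ` range embed" using range by blast
      then obtain u where "embed v = \<sigma> (embed u)" by blast
      then have "embed v = embed (?g u)" by (simp add: g)
      then show ?thesis using embed_inj by (blast dest: injD)
    qed
    then show "surj ?g" by blast
  qed
  moreover have "form (?g u) (?g v) = form u v" for u v
  proof -
    have pairing: "hmode u 1 (embed v) = form u v *\<^sub>C vacuum" for u v :: 'h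
      using annihilate_creation[of 1 u v] by (simp add: embed_def)
    have "\<sigma> (hmode u 1 (embed v)) = form u v *\<^sub>C vacuum"
      by (simp add: pairing clinear_scale[OF lin] vac)
    moreover have "\<sigma> (hmode u 1 (embed v)) = form (?g u) (?g v) *\<^sub>C vacuum"
      unfolding hmode g[symmetric] by (rule pairing)
    ultimately show ?thesis by (simp add: vacuum_nonzero)
  qed
  ultimately show orth: "orthogonal ?g" by (simp add: orthogonal_def)
  show "\<sigma> = fock_lift ?g"
    by (rule ext, rule intertwiner_unique[where g = ?g])
      (simp_all add: lin vac hmode fock_lift_linear[OF orth] fock_lift_vacuum[OF orth]
        fock_lift_hmode[OF orth])
qed

lemma restrict_fock_lift:
  assumes "orthogonal g"
  shows "restrict_to_h (fock_lift g) = g"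
  by (simp add: restrict_to_h_def fun_eq_iff fock_lift_embed[OF assms] inv_f_f embed_inj)

lemma restrict_iso: "restrict_to_h \<in> iso (graded_va_aut vacuum Y heis_grade) orthogonal_group"
proof -
  let ?S = "{\<sigma>. va_automorphism vacuum Y \<sigma> \<and> (\<forall>n. \<sigma> ` heis_grade n = heis_grade n)}"
  have mult: "restrict_to_h (\<sigma> \<circ> \<tau>) = restrict_to_h \<sigma> \<circ> restrict_to_h \<tau>" if "\<sigma> \<in> ?S" "\<tau> \<in> ?S" for \<sigma> \<tau>
  proof
    fix u
    have comp: "va_automorphism vacuum Y (\<sigma> \<circ> \<tau>)" "(\<sigma> \<circ> \<tau>) ` heis_grade 1 = heis_grade 1"
      using that va_automorphism_comp[of vacuum Y \<sigma> \<tau>] unfolding image_comp[symmetric] by simp_all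
    have "embed (restrict_to_h (\<sigma> \<circ> \<tau>) u) = embed (restrict_to_h \<sigma> (restrict_to_h \<tau> u))"
      using that by (simp add: embed_restrict[OF comp] embed_restrict)
    then show "restrict_to_h (\<sigma> \<circ> \<tau>) u = (restrict_to_h \<sigma> \<circ> restrict_to_h \<tau>) u"
      using embed_inj by (auto dest: injD)
  qed
  have "bij_betw restrict_to_h ?S {g. orthogonal g}"
  proof (rule bij_betw_byWitness[where f' = fock_lift])
    show "\<forall>\<sigma>\<in>?S. fock_lift (restrict_to_h \<sigma>) = \<sigma>"
      using automorphism_eq_fock_lift by (metis (mono_tags, lifting) mem_Collect_eq)
    show "\<forall>g\<in>{g. orthogonal g}. restrict_to_h (fock_lift g) = g"
      by (simp add: restrict_fock_lift)
    show "restrict_to_h ` ?S \<subseteq> {g. orthogonal g}"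
      using restrict_orthogonal by blast
    show "fock_lift ` {g. orthogonal g} \<subseteq> ?S"
      using fock_lift_automorphism fock_lift_grade by blast
  qed
  with mult show ?thesis
    by (auto simp: iso_def hom_def graded_va_aut_def orthogonal_group_eq restrict_orthogonal)
qed

text \<open>
  The mode of index \<open>1\<close> of the conformal vector is the degree operator \<open>L(0)\<close>, and \<open>x(m)\<close> lowers the
  degree by \<open>m\<close>. The dependence on \<open>h\<close> drops out: the summand of the commutator
  formula at \<open>i = 2\<close> that contains it is a multiple of the mode of index \<open>m - 1\<close> of the vacuum,
  which is zero unless \<open>m = 0\<close>, and then its binomial coefficient vanishes.
\<close>

lemma L0_hmode:
  assumes bs: "orthonormal_basis bs"
  shows "Y (omega bs h) 1 (hmode x m w) =
    hmode x m (Y (omega bs h) 1 w) - of_int m *\<^sub>C hmode x m w"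
proof -
  have "hmode x m (Y (omega bs h) 1 w) - Y (omega bs h) 1 (hmode x m w) =
      Sum_any (\<lambda>i::nat. (of_int m gchoose i) *\<^sub>C Y (hmode x (int i) (omega bs h)) (m + 1 - int i) w)"
    using commutator[of "embed x" m "omega bs h" 1 w] by (simp add: Y_embed)
  also have "\<dots> = Sum_any (\<lambda>i::nat. if i = 1 then of_int m *\<^sub>C hmode x m w else 0)"
  proof (rule arg_cong[where f = Sum_any], rule ext)
    fix i :: nat
    show "(of_int m gchoose i) *\<^sub>C Y (hmode x (int i) (omega bs h)) (m + 1 - int i) w =
        (if i = 1 then of_int m *\<^sub>C hmode x m w else 0)"
    proof (cases "i = 2")
      case True
      have "(of_int m gchoose 2) *\<^sub>C Y (((2 * form x h)) *\<^sub>C vacuum) (m - 1) w = 0"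
        by (cases "m = 0")
          (simp_all add: clinear_scale[OF Y_linear_left] vacuum_left numeral_2_eq_2)
      with True show ?thesis by (simp add: hmode_omega[OF bs])
    next
      case False
      then show ?thesis
        by (simp add: hmode_omega[OF bs] Y_embed clinear_zero[OF Y_linear_left])
    qed
  qed
  also have "\<dots> = of_int m *\<^sub>C hmode x m w"
    by (simp add: Sum_any.expand_superset[of "{1}"])
  finally show ?thesis by (simp add: algebra_simps)
qed

text \<open>
  The products of creation operators are eigenvectors of \<open>L(0)\<close> with their degree as eigenvalue, and they span.
  Conversely, an eigenvector for \<open>n\<close> splits into homogeneous components, and those of degree
  other than \<open>n\<close> vanish because eigenvectors for distinct eigenvalues are independent.
\<close>

lemma heis_grade_eigenspace:
  assumes bs: "orthonormal_basis bs"
  shows "heis_grade n = {v. Y (omega bs h) 1 v = of_nat n *\<^sub>C v}"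
proof -
  let ?L = "Y (omega bs h) 1"
  have word: "?L (create us) = of_nat (sum_list (map snd us)) *\<^sub>C create us" for us
  proof (induction us)
    case Nil
    then show ?case by (simp add: creation_regular)
  next
    case (Cons a us)
    then show ?case
      by (simp add: L0_hmode[OF bs] case_prod_unfold clinear_scale[OF hmode_linear] algebra_simps
          flip: scaleC_add_left)
  qed
  have sub: "heis_grade i \<subseteq> {v. ?L v = of_nat i *\<^sub>C v}" for i
    unfolding heis_grade_eq
  proof (rule cvs.span_minimal)
    show "cvs.subspace {v. ?L v = of_nat i *\<^sub>C v}"
      by (auto simp: cvs.subspace_def clinear_zero[OF Y_linear_right] clinear_add[OF Y_linear_right]
          clinear_scale[OF Y_linear_right] scaleC_add_right scaleC_scaleC mult.commute)
  qed (auto simp: word)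
  have "v \<in> heis_grade n" if v: "?L v = of_nat n *\<^sub>C v" for v
  proof -
    obtain A f where f: "finite A" "\<And>i. f i \<in> heis_grade i" "v = (\<Sum>i\<in>A. f i)"
      using graded_decomposition[of v] by blast
    have Lf: "?L (f i) = of_nat i *\<^sub>C f i" for i using f(2) sub by blast
    \<comment> \<open>The components of \<open>L(0) v - n v = 0\<close>, again eigenvectors.\<close>
    let ?f' = "\<lambda>i. (of_nat i - of_nat n) *\<^sub>C f i"
    have "(\<Sum>i\<in>A. ?f' i) = ?L v - of_nat n *\<^sub>C v"
      by (simp add: f(3) clinear_sum[OF Y_linear_right] Lf cvs.scale_left_diff_distrib
          sum_subtractf cvs.scale_sum_right)
    then have sum0: "(\<Sum>i\<in>A. ?f' i) = 0" using v by simp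
    have "?f' i = 0" if "i \<in> A" for i
      by (rule eigenvectors_independent[OF Y_linear_right _ f(1) sum0 that, of "omega bs h" 1])
        (simp add: clinear_scale[OF Y_linear_right] Lf scaleC_scaleC mult.commute)
    then have "f i = 0" if "i \<in> A" "i \<noteq> n" for i
      using that by (metis cvs.scale_eq_0_iff of_nat_eq_iff right_minus_eq)
    then have "v = (if n \<in> A then f n else 0)"
      using f(1) unfolding f(3) by (auto simp: sum.remove[of A n] intro: sum.neutral)
    then show ?thesis using f(2) by (simp add: heis_grade_eq cvs.span_zero)
  qed
  with sub show ?thesis by blast
qed

text \<open>
  An automorphism that fixes the conformal vector commutes with \<open>L(0)\<close>, so it preserves the
  eigenspaces of \<open>L(0)\<close>.
\<close>

lemma voa_automorphism_graded:
  assumes bs: "orthonormal_basis bs" and \<sigma>: "va_automorphism vacuum Y \<sigma>"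
    and omega: "\<sigma> (omega bs h) = omega bs h"
  shows "\<sigma> ` heis_grade n = heis_grade n"
proof -
  let ?L = "Y (omega bs h) 1"
  have lin: "clinear \<sigma>" and bij: "bij \<sigma>" and L: "\<And>v. \<sigma> (?L v) = ?L (\<sigma> v)"
    using \<sigma> omega by (auto simp: va_automorphism_def)
  have iff: "\<sigma> v \<in> heis_grade n \<longleftrightarrow> v \<in> heis_grade n" for v
  proof -
    have "\<sigma> v \<in> heis_grade n \<longleftrightarrow> \<sigma> (?L v) = \<sigma> (of_nat n *\<^sub>C v)"
      by (simp add: heis_grade_eigenspace[OF bs, of n h] L clinear_scale[OF lin])
    also have "\<dots> \<longleftrightarrow> v \<in> heis_grade n"
      by (simp add: heis_grade_eigenspace[OF bs, of n h] inj_eq[OF bij_is_inj[OF bij]])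
    finally show ?thesis .
  qed
  have "(heis_grade n :: 'h heis set) \<subseteq> \<sigma> ` heis_grade n"
  proof
    fix v :: "'h heis" assume "v \<in> heis_grade n"
    moreover obtain w where "v = \<sigma> w" using bij_is_surj[OF bij] by (rule surjE)
    ultimately show "v \<in> \<sigma> ` heis_grade n" using iff by blast
  qed
  with iff show ?thesis by blast
qed

lemma voa_aut_subset:
  assumes "orthonormal_basis bs"
  shows "carrier (voa_aut vacuum Y (omega bs h)) \<subseteq> carrier (graded_va_aut vacuum Y heis_grade)"
  unfolding voa_aut_def graded_va_aut_def map_group_simps
  using voa_automorphism_graded[OF assms] by blast

lemma restrict_iso_isotropy:
  assumes bs: "orthonormal_basis bs"
  shows "restrict_to_h \<in> iso (voa_aut vacuum Y (omega bs h)) (isotropy_group h)"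
  unfolding voa_aut_def isotropy_group_def
proof (rule iso_map_group_restrict)
  show "restrict_to_h \<in> iso
      (map_group {\<sigma>. va_automorphism vacuum Y \<sigma> \<and> (\<forall>n. \<sigma> ` heis_grade n = heis_grade n)})
      (map_group {g. orthogonal g})"
    using restrict_iso by (simp add: graded_va_aut_def orthogonal_group_eq)
  show "{\<sigma>. va_automorphism vacuum Y \<sigma> \<and> \<sigma> (omega bs h) = omega bs h} \<subseteq>
      {\<sigma>. va_automorphism vacuum Y \<sigma> \<and> (\<forall>n. \<sigma> ` heis_grade n = heis_grade n)}"
    using voa_automorphism_graded[OF bs] by blast
  show "{g \<in> carrier orthogonal_group. g h = h} \<subseteq> {g. orthogonal g}"
    by (auto simp: orthogonal_group_eq)
  fix \<sigma> assume "\<sigma> \<in> {\<sigma>. va_automorphism vacuum Y \<sigma> \<and> (\<forall>n. \<sigma> ` heis_grade n = heis_grade n)}"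
  then have \<sigma>: "va_automorphism vacuum Y \<sigma>" "\<sigma> ` heis_grade 1 = heis_grade 1" by auto
  have "\<sigma> (omega bs h) = omega bs h \<longleftrightarrow> restrict_to_h \<sigma> h = h"
    using fock_lift_omega[OF bs restrict_orthogonal[OF \<sigma>], of h]
    by (simp flip: automorphism_eq_fock_lift[OF \<sigma>])
  then show "\<sigma> \<in> {\<sigma>. va_automorphism vacuum Y \<sigma> \<and> \<sigma> (omega bs h) = omega bs h} \<longleftrightarrow>
      restrict_to_h \<sigma> \<in> {g \<in> carrier orthogonal_group. g h = h}"
    using \<sigma> by (simp add: orthogonal_group_eq restrict_orthogonal)
qed

end

lemma isotropy_group_zero: "isotropy_group 0 = orthogonal_group"
proof -
  have "g 0 = 0" if "orthogonal g" for g :: "'a \<Rightarrow> 'a"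
    using that by (simp add: orthogonal_def clinear_zero)
  then have "{g \<in> carrier orthogonal_group. g (0 :: 'a) = 0} = {g. orthogonal g}"
    by (auto simp: orthogonal_group_eq)
  then show ?thesis unfolding isotropy_group_def orthogonal_group_eq by simp
qed

theorem theorem1p1:
  fixes Y :: "'h::formed_space heis \<Rightarrow> int \<Rightarrow> 'h heis \<Rightarrow> 'h heis"
  assumes "heisenberg_vertex_structure Y"
  shows
    "clinear (embed :: 'h \<Rightarrow> 'h heis) \<and> bij_betw (embed :: 'h \<Rightarrow> 'h heis) UNIV (heis_grade 1)
     \<and> group (orthogonal_group :: ('h \<Rightarrow> 'h) monoid)
     \<and> group (graded_va_aut vacuum Y heis_grade)
     \<and> restrict_to_h \<in> iso (graded_va_aut vacuum Y heis_grade) orthogonal_group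
     \<and> (\<forall>bs h. orthonormal_basis bs \<longrightarrow>
          group (voa_aut vacuum Y (omega bs h))
          \<and> carrier (voa_aut vacuum Y (omega bs h))
              \<subseteq> carrier (graded_va_aut vacuum Y heis_grade)
          \<and> restrict_to_h \<in> iso (voa_aut vacuum Y (omega bs h)) (isotropy_group h))
     \<and> (\<forall>bs. orthonormal_basis bs \<longrightarrow>
          restrict_to_h \<in> iso (voa_aut vacuum Y (omega bs 0)) orthogonal_group)"
proof -
  interpret heisenberg_vertex_algebra Y
    by (rule heisenberg_vertex_algebra.intro)
      (use assms in \<open>auto simp: heisenberg_vertex_structure_def heisenberg_vertex_algebra_axioms_def\<close>)
  have "bij_betw (embed :: 'h \<Rightarrow> 'h heis) UNIV (heis_grade 1)"
    unfolding heis_grade_1 by (rule inj_on_imp_bij_betw[OF embed_inj])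
  then show ?thesis
    using embed_linear group_orthogonal group_graded_va_aut restrict_iso group_voa_aut
      voa_aut_subset restrict_iso_isotropy restrict_iso_isotropy[of _ 0, unfolded isotropy_group_zero]
    by blast
qed

end
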